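(* Let $N\ge2$, $k\ge1$, $0\le m\le k$ and $0\le t\le N-1$. Let $[m\lambda_1]$ and $[k\lambda_1]$ be the $S_k$-orbits in $\mathbb{Z}_N^k$ corresponding to the weights $m\lambda_1$ and $k\lambda_1$, let $\lambda\in P_k^+$ be the weight whose corresponding orbit is $[\lambda]=[m\lambda_1]\times[k\lambda_1]^t$ (this product is a single orbit), and let $\mu\in P_k^+$ be any weight of level $k$. Then for every weight $\nu\in P_k^+$ of level $k$, $$N_{\lambda,\mu}^{(k)\nu}=M_{[\lambda],[\mu]}^{(k)[\nu]}.$$
   Context: Weights: $\lambda_1,\dots,\lambda_{N-1}$ are the fundamental weights of $sl_N$ (type $A_{N-1}$), and the weights of level $k$ are $P_k^+=\{\sum_{j=1}^{N-1}a_j\lambda_j : a_j\in\mathbb{Z}_{\ge 0},\ \sum_{j=1}^{N-1} a_j\le k\}$. Orbits: $S_k$ acts on $\mathbb{Z}_N^k$ (where $\mathbb{Z}_N=\mathbb{Z}/N\mathbb{Z}$) by permuting coordinates; $[x]$ is the orbit of $x$, and $\mathcal{O}(N,k)$ is the set of orbits. A weight $\lambda=\sum_{j=1}^{N-1} a_j\lambda_j\in P_k^+$ corresponds to the orbit $[\lambda]=[((N-1)^{a_{N-1}},\dots,1^{a_1},0^{a_0})]$, $a_0=k-\sum_{j\ge1}a_j$, where exponents denote numbers of repetitions. This is a bijection between $P_k^+$ and $\mathcal{O}(N,k)$. For orbits $[a],[b],[c]$ let $T([a],[b],[c])=\{(x,y,z)\in[a]\times[b]\times[c] : x+y=z\}$,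 with $S_k$ acting by $\sigma(x,y,z)=(\sigma x,\sigma y,\sigma z)$; $M_{[a],[b]}^{(k)[c]}$ is the number of $S_k$-orbits of $T([a],[b],[c])$. The (bilinear, in general non-associative) orbit product on formal linear combinations of orbits is $[a]\times[b]=\sum_{[c]\in\mathcal{O}(N,k)}M_{[a],[b]}^{(k)[c]}[c]$. One has $[k\lambda_1]=[(1^k)]$ and $[k\lambda_1]^t=[(t^k)]$ for $0\le t\le N-1$, with $[k\lambda_1]^0=[(0^k)]$. Fusion coefficients: Let $\Lambda_N=\mathbb{Q}[x_1,\dots,x_N]^{S_N}$, with $h_m$ the complete homogeneous symmetric polynomials ($h_0=1$, $h_m=0$ for $m<0$), and for a partition $(\mu)=(\mu_1,\dots,\mu_N)$ of length at most $N$ let $S_{(\mu)}=\det(h_{\mu_i-i+j})_{i,j=1}^N$ be the Schur polynomial. Let $I^{(N,k)}$ be the ideal of $\Lambda_N$ generated by $S_{(1^N)}-1$ and all $S_{(\mu)}$ with $\mu_1-\mu_N=k+1$. To $\lambda=\sum a_j\lambda_j\in P_k^+$ associate the partition $(\lambda)=(\sum_{j\ge1}a_j,\sum_{j\ge2}a_j,\dots,a_{N-1})$. The fusion algebra $\mathcal{F}(A_{N-1},k)$ is $\Lambda_N/I^{(N,k)}$ (Goodman–Wenzl); the classes of $S_{(\lambda)}$, $\lambda\in P_k^+$, form a $\mathbb{Q}$-basis, and the fusion coefficients are the structure constants: $S_{(\lambda)}S_{(\mu)}=\sum_{\nu\in P_k^+}N_{\lambda,\mu}^{(k)\nu}S_{(\nu)}$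 in $\Lambda_N/I^{(N,k)}$. *)

theory Defs
  imports
    Jordan_Normal_Form.Determinant
    "HOL-Algebra.QuotRing"
    "HOL-Combinatorics.Permutations"
    "HOL-Library.Poly_Mapping"
begin

section \<open>Weights of level k\<close>

text \<open>The weight \<open>a\<^sub>1 \<lambda>\<^sub>1 + \<dots> + a\<^sub>N\<^sub>-\<^sub>1 \<lambda>\<^sub>N\<^sub>-\<^sub>1\<close> is represented by its coefficient function \<open>a\<close>,
  extended by zero outside \<open>{1..<N}\<close>.\<close>

type_synonym weight = "nat \<Rightarrow> nat"

definition weights :: "nat \<Rightarrow> nat \<Rightarrow> weight set" where
  "weights N k = {a. (\<forall>j. j \<notin> {1..<N} \<longrightarrow> a j = 0) \<and> (\<Sum>j = 1..<N. a j) \<le> k}"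

definition fundamental_weight :: "nat \<Rightarrow> weight" where
  "fundamental_weight j = (\<lambda>i. if i = j then 1 else 0)"

definition scale_weight :: "nat \<Rightarrow> weight \<Rightarrow> weight" where
  "scale_weight m a = (\<lambda>j. m * a j)"


section \<open>Orbits and the orbit product\<close>

text \<open>An element of \<open>\<int>\<^sub>N\<^sup>k\<close> is a list of length \<open>k\<close> whose entries are the standard representatives
  \<open>0, \<dots>, N - 1\<close>.\<close>

definition tuples :: "nat \<Rightarrow> nat \<Rightarrow> nat list set" where
  "tuples N k = {x. length x = k \<and> set x \<subseteq> {0..<N}}"

definition add_tuple :: "nat \<Rightarrow> nat list \<Rightarrow> nat list \<Rightarrow> nat list" where
  "add_tuple N x y = map2 (\<lambda>a b. (a + b) mod N) x y"

text \<open>\<^const>\<open>permute_list\<close> is a right action of the permutations of \<open>{..<k}\<close>; its orbits are those of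
  the corresponding left action by inverses.\<close>

definition perm_orbit :: "nat \<Rightarrow> nat list \<Rightarrow> nat list set" where
  "perm_orbit k x = {permute_list \<sigma> x | \<sigma>. \<sigma> permutes {..<k}}"

definition orbit_set :: "nat \<Rightarrow> nat \<Rightarrow> nat list set set" where
  "orbit_set N k = perm_orbit k ` tuples N k"

definition weight_orbit :: "nat \<Rightarrow> nat \<Rightarrow> weight \<Rightarrow> nat list set" where
  "weight_orbit N k a =
     perm_orbit k
       (concat (map (\<lambda>j. replicate (a j) j) (rev [1..<N])) @ replicate (k - (\<Sum>j = 1..<N. a j)) 0)"

definition sum_triples ::
    "nat \<Rightarrow> nat list set \<Rightarrow> nat list set \<Rightarrow> nat list set \<Rightarrow> (nat list \<times> nat list \<times> nat list) set" where
  "sum_triples N A B C = {(x, y, z). x \<in> A \<and> y \<in> B \<and> z \<in> C \<and> add_tuple N x y = z}"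

definition triple_orbit ::
    "nat \<Rightarrow> nat list \<times> nat list \<times> nat list \<Rightarrow> (nat list \<times> nat list \<times> nat list) set" where
  "triple_orbit k = (\<lambda>(x, y, z).
     {(permute_list \<sigma> x, permute_list \<sigma> y, permute_list \<sigma> z) | \<sigma>. \<sigma> permutes {..<k}})"

definition orbit_coeff ::
    "nat \<Rightarrow> nat \<Rightarrow> nat list set \<Rightarrow> nat list set \<Rightarrow> nat list set \<Rightarrow> nat" where
  "orbit_coeff N k A B C = card (triple_orbit k ` sum_triples N A B C)"

text \<open>Formal rational linear combinations of orbits are finitely supported functions; the orbit \<open>A\<close>
  itself is \<open>Poly_Mapping.single A 1\<close>.\<close>

type_synonym orbit_comb = "nat list set \<Rightarrow>\<^sub>0 rat"

definition orbit_prod :: "nat \<Rightarrow> nat \<Rightarrow> orbit_comb \<Rightarrow> orbit_comb \<Rightarrow> orbit_comb" where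
  "orbit_prod N k u v =
     (\<Sum>A\<in>Poly_Mapping.keys u. \<Sum>B\<in>Poly_Mapping.keys v. \<Sum>C\<in>orbit_set N k.
        Poly_Mapping.single C
          (Poly_Mapping.lookup u A * Poly_Mapping.lookup v B * of_nat (orbit_coeff N k A B C)))"

text \<open>The orbit product is not associative in general, so powers are bracketed to the left.
  For the powers of \<open>[k\<lambda>\<^sub>1]\<close> the bracketing does not matter.\<close>

fun orbit_power :: "nat \<Rightarrow> nat \<Rightarrow> orbit_comb \<Rightarrow> nat \<Rightarrow> orbit_comb" where
  "orbit_power N k u 0 = Poly_Mapping.single (perm_orbit k (replicate k 0)) 1"
| "orbit_power N k u (Suc t) = orbit_prod N k (orbit_power N k u t) u"


section \<open>Symmetric polynomials and the fusion algebra\<close>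

text \<open>Monomials are exponent vectors; the variables \<open>x\<^sub>1, \<dots>, x\<^sub>N\<close> have indices \<open>0, \<dots>, N - 1\<close>.\<close>

type_synonym monomial = "nat \<Rightarrow>\<^sub>0 nat"
type_synonym mpolynomial = "monomial \<Rightarrow>\<^sub>0 rat"

definition monomials :: "nat \<Rightarrow> monomial set" where
  "monomials N = {e. Poly_Mapping.keys e \<subseteq> {..<N}}"

definition const_poly :: "rat \<Rightarrow> mpolynomial" where
  "const_poly q = Poly_Mapping.single 0 q"

text \<open>The monomial \<open>map_key \<sigma> e\<close> has exponent \<open>e (\<sigma> i)\<close> at the variable \<open>i\<close>, so the second condition
  says that \<open>p\<close> is invariant under all permutations of the variables.\<close>

definition symmetric_polys :: "nat \<Rightarrow> mpolynomial set" where
  "symmetric_polys N =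
     {p. Poly_Mapping.keys p \<subseteq> monomials N \<and>
         (\<forall>\<sigma> e. \<sigma> permutes {..<N} \<longrightarrow>
           Poly_Mapping.lookup p (Poly_Mapping.map_key \<sigma> e) = Poly_Mapping.lookup p e)}"

definition symmetric_ring :: "nat \<Rightarrow> mpolynomial ring" where
  "symmetric_ring N =
     \<lparr>carrier = symmetric_polys N, monoid.mult = (*), one = 1, zero = 0, add = (+)\<rparr>"

definition complete_homogeneous :: "nat \<Rightarrow> int \<Rightarrow> mpolynomial" where
  "complete_homogeneous N m =
     (if m < 0 then 0
      else \<Sum>e \<in> {e \<in> monomials N. (\<Sum>i<N. Poly_Mapping.lookup e i) = nat m}. Poly_Mapping.single e 1)"

text \<open>Partitions of length at most \<open>N\<close>, padded with zeros to lists of length \<open>N\<close>.\<close>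

definition partitions :: "nat \<Rightarrow> nat list set" where
  "partitions N = {\<mu>. length \<mu> = N \<and> sorted_wrt (\<ge>) \<mu>}"

definition schur :: "nat \<Rightarrow> nat list \<Rightarrow> mpolynomial" where
  "schur N \<mu> = det (mat N N (\<lambda>(i, j). complete_homogeneous N (int (\<mu> ! i) - int i + int j)))"

definition fusion_ideal :: "nat \<Rightarrow> nat \<Rightarrow> mpolynomial set" where
  "fusion_ideal N k =
     Idl\<^bsub>symmetric_ring N\<^esub>
       (insert (schur N (replicate N 1) - 1)
          {schur N \<mu> | \<mu>. \<mu> \<in> partitions N \<and> \<mu> ! 0 - \<mu> ! (N - 1) = k + 1})"

definition fusion_algebra :: "nat \<Rightarrow> nat \<Rightarrow> mpolynomial set ring" where
  "fusion_algebra N k = symmetric_ring N Quot fusion_ideal N k"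

definition fusion_class :: "nat \<Rightarrow> nat \<Rightarrow> mpolynomial \<Rightarrow> mpolynomial set" where
  "fusion_class N k p = fusion_ideal N k +>\<^bsub>symmetric_ring N\<^esub> p"

definition weight_partition :: "nat \<Rightarrow> weight \<Rightarrow> nat list" where
  "weight_partition N a = map (\<lambda>i. \<Sum>j = i..<N. a j) [1..<Suc N]"

definition schur_class :: "nat \<Rightarrow> nat \<Rightarrow> weight \<Rightarrow> mpolynomial set" where
  "schur_class N k a = fusion_class N k (schur N (weight_partition N a))"

text \<open>The coordinates of \<open>S\<^sub>\<kappa> S\<^sub>\<mu>\<close> in the basis of classes \<open>S\<^sub>\<nu>\<close>, extended by zero outside the weights
  of level \<open>k\<close> so that they are determined uniquely. Scalars act through the classes of constants.\<close>

definition is_fusion_expansion ::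
    "nat \<Rightarrow> nat \<Rightarrow> weight \<Rightarrow> weight \<Rightarrow> (weight \<Rightarrow> rat) \<Rightarrow> bool" where
  "is_fusion_expansion N k \<kappa> \<mu> c \<longleftrightarrow>
     (\<forall>\<nu>. \<nu> \<notin> weights N k \<longrightarrow> c \<nu> = 0) \<and>
     schur_class N k \<kappa> \<otimes>\<^bsub>fusion_algebra N k\<^esub> schur_class N k \<mu> =
       (\<Oplus>\<^bsub>fusion_algebra N k\<^esub> \<nu> \<in> weights N k.
          fusion_class N k (const_poly (c \<nu>)) \<otimes>\<^bsub>fusion_algebra N k\<^esub> schur_class N k \<nu>)"

definition fusion_coeff :: "nat \<Rightarrow> nat \<Rightarrow> weight \<Rightarrow> weight \<Rightarrow> weight \<Rightarrow> rat" where
  "fusion_coeff N k \<kappa> \<mu> \<nu> = (THE c. is_fusion_expansion N k \<kappa> \<mu> c) \<nu>"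

end

theory Submission
  imports Defs "HOL-Computational_Algebra.Formal_Power_Series"
begin

text \<open>
  A weight of level \<open>k\<close> is handled through its content \<open>b\<close>, where \<open>b i\<close> is the number of entries \<open>i\<close> in a
  tuple of the corresponding orbit, so that \<open>b 0 + \<dots> + b (N - 1) = k\<close>. Its Schur polynomial is the
  Jacobi-Trudi determinant \<open>D(a)\<close> with the strictly decreasing exponents
  \<open>a i = (b (i + 1) + 1) + \<dots> + (b (N - 1) + 1)\<close>. Both sides of the claimed equation turn out to be the
  number of ways to move \<open>m\<close> of the \<open>k\<close> entries one residue forward, and then all of them \<open>t\<close> residues,
  so that the content of \<open>\<mu>\<close> becomes that of \<open>\<nu>\<close>.

  \<^bold>\<open>Orbits.\<close> The orbit of \<open>\<lambda>\<close> consists of the arrangements of \<open>m\<close> entries \<open>t + 1\<close> and \<open>k - m\<close> entries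
  \<open>t\<close> modulo \<open>N\<close>. A triple \<open>(x, y, x + y)\<close> is determined up to permutation by the multiset of pairs of
  corresponding entries of \<open>x\<close> and \<open>y\<close>, hence by the numbers \<open>d j\<close> of pairs \<open>(t + 1, j)\<close>. These satisfy
  \<open>d j \<le> b j\<close> and have sum \<open>m\<close>, and the content of \<open>x + y\<close> is \<open>b i - d i + d (i - 1)\<close> rotated \<open>t\<close> times
  (\<open>orbit_coeff_eq_card_moves\<close>).

  \<^bold>\<open>Fusion.\<close> The classical Pieri rule \<open>h\<^sub>m D(a) = \<Sum>\<^sub>d D(a + d)\<close>, over all \<open>d\<close> with sum \<open>m\<close>, follows from the
  bialternant formula. Modulo the fusion ideal \<open>h\<^sub>k\<^sub>+\<^sub>1, \<dots>, h\<^sub>k\<^sub>+\<^sub>N\<^sub>-\<^sub>1\<close> vanish, because the ideal contains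
  the Schur polynomials of the hooks with first row \<open>k + 1\<close>. With the linear recurrence that the \<open>h\<^sub>j\<close> satisfy this gives
  \<open>h\<^sub>j\<^sub>+\<^sub>N\<^sub>+\<^sub>k = \<plusminus> h\<^sub>k h\<^sub>j\<close> for all \<open>j > - N\<close>. So raising any one exponent of \<open>D\<close> by \<open>N + k\<close> multiplies \<open>D\<close> by the
  same factor, and \<open>D\<close> is alternating under the whole affine Weyl group. Two sign-reversing involutions
  then cancel all terms of the Pieri rule except those with \<open>d i \<le> b i\<close> for all \<open>i\<close>, which gives
  \<open>fusion_pieri\<close>: the products by \<open>h\<^sub>m\<close> are indexed by the same \<open>d\<close> as above. For \<open>m = k\<close> only \<open>d = b\<close> is
  left, so \<open>h\<^sub>k\<close> rotates contents. Therefore \<open>S\<^sub>\<lambda> = h\<^sub>k\<^sup>t h\<^sub>m\<close> in the fusion algebra, and \<open>fusion_product\<close>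
  expands \<open>S\<^sub>\<lambda> S\<^sub>\<mu>\<close>.

  \<^bold>\<open>Independence.\<close> Fusion coefficients can be read off this expansion once the classes of the \<open>S\<^sub>\<nu>\<close> are
  known to be linearly independent. Multiply by the Vandermonde alternant and pair the result with a
  function on exponent vectors that is constant on cosets of the lattice spanned by \<open>(1, \<dots>, 1)\<close> and
  \<open>N + k\<close> times the root lattice. All elements of the fusion ideal pair to zero, whereas indicator
  functions of cosets separate the \<open>S\<^sub>\<nu>\<close>, since distinct exponents in the interior of the fundamental
  alcove are not conjugate under the affine Weyl group.
\<close>

section \<open>Complete homogeneous and elementary symmetric polynomials\<close>

abbreviation X :: "nat \<Rightarrow> mpolynomial" where
  "X j \<equiv> Poly_Mapping.single (Poly_Mapping.single j 1) 1"

definition monomials_of_degree :: "nat \<Rightarrow> nat \<Rightarrow> monomial set" where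
  "monomials_of_degree N m = {e \<in> monomials N. (\<Sum>i<N. Poly_Mapping.lookup e i) = m}"

lemma monomials_of_degree_eq_zero:
  assumes "N = 0 \<or> m = 0"
  shows "monomials_of_degree N m \<subseteq> {0}"
proof
  fix e assume e: "e \<in> monomials_of_degree N m"
  have "Poly_Mapping.lookup e i = 0" for i
  proof (cases "i < N")
    case True
    then show ?thesis using e assms
      by (auto simp: monomials_of_degree_def)
  next
    case False
    then have "i \<notin> Poly_Mapping.keys e"
      using e by (auto simp: monomials_of_degree_def monomials_def)
    then show ?thesis by (simp add: in_keys_iff)
  qed
  then show "e \<in> {0}" by (simp add: poly_mapping_eqI)
qed

lemma monomials_of_degree_Suc:
  "monomials_of_degree (Suc N) (Suc n) =
     monomials_of_degree N (Suc n) \<union>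
     (\<lambda>e. Poly_Mapping.single N 1 + e) ` monomials_of_degree (Suc N) n" (is "?L = ?A \<union> ?B")
proof
  show "?L \<subseteq> ?A \<union> ?B"
  proof
    fix e assume e: "e \<in> ?L"
    show "e \<in> ?A \<union> ?B"
    proof (cases "Poly_Mapping.lookup e N = 0")
      case True
      have "Poly_Mapping.keys e \<subseteq> {..<Suc N}" "N \<notin> Poly_Mapping.keys e"
        using e True by (simp_all add: monomials_of_degree_def monomials_def in_keys_iff)
      then have "Poly_Mapping.keys e \<subseteq> {..<N}"
        unfolding lessThan_Suc by blast
      then show ?thesis using e True
        by (auto simp: monomials_of_degree_def monomials_def)
    next
      case False
      define f where "f = e - Poly_Mapping.single N 1"
      have ef: "e = Poly_Mapping.single N 1 + f"
        using False by (intro poly_mapping_eqI)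
          (auto simp: f_def lookup_add lookup_minus lookup_single when_def)
      have "Poly_Mapping.keys f \<subseteq> Poly_Mapping.keys e"
        by (auto simp: in_keys_iff ef lookup_add)
      moreover have "(\<Sum>i<Suc N. Poly_Mapping.lookup e i) = Suc (\<Sum>i<Suc N. Poly_Mapping.lookup f i)"
        by (simp add: ef lookup_add lookup_single sum.distrib when_def)
      ultimately have "f \<in> monomials_of_degree (Suc N) n"
        using e by (auto simp: monomials_of_degree_def monomials_def)
      then show ?thesis using ef by blast
    qed
  qed
next
  have "e \<in> ?L" if "e \<in> ?A" for e
  proof -
    have "N \<notin> Poly_Mapping.keys e" using that by (auto simp: monomials_of_degree_def monomials_def)
    then show ?thesis using that
      by (auto simp: monomials_of_degree_def monomials_def in_keys_iff less_Suc_eq)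
  qed
  moreover have "e \<in> ?L" if "e \<in> ?B" for e
  proof -
    from that obtain f where f: "e = Poly_Mapping.single N 1 + f" "f \<in> monomials_of_degree (Suc N) n"
      by blast
    have "Poly_Mapping.keys e \<subseteq> {..<Suc N}"
      using f keys_add[of "Poly_Mapping.single N 1" f] by (auto simp: monomials_of_degree_def monomials_def)
    moreover have "(\<Sum>i<Suc N. Poly_Mapping.lookup e i) = Suc (\<Sum>i<Suc N. Poly_Mapping.lookup f i)"
      by (simp add: f lookup_add lookup_single sum.distrib when_def)
    ultimately show ?thesis using f
      by (auto simp: monomials_of_degree_def monomials_def)
  qed
  ultimately show "?A \<union> ?B \<subseteq> ?L" by blast
qed

lemma finite_monomials_of_degree: "finite (monomials_of_degree N m)"
proof (induction N arbitrary: m)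
  case 0
  show ?case by (rule finite_subset[OF monomials_of_degree_eq_zero]) auto
next
  case (Suc N)
  show ?case
  proof (induction m)
    case 0
    show ?case by (rule finite_subset[OF monomials_of_degree_eq_zero]) auto
  next
    case (Suc m)
    then show ?case using \<open>\<And>m. finite (monomials_of_degree N m)\<close>
      by (simp add: monomials_of_degree_Suc)
  qed
qed

definition hom_poly :: "nat \<Rightarrow> nat \<Rightarrow> mpolynomial" where
  "hom_poly N m = (\<Sum>e \<in> monomials_of_degree N m. Poly_Mapping.single e 1)"

lemma complete_homogeneous_eq:
  "complete_homogeneous N m = (if m < 0 then 0 else hom_poly N (nat m))"
  by (simp add: complete_homogeneous_def hom_poly_def monomials_of_degree_def)

lemma lookup_hom_poly:
  "Poly_Mapping.lookup (hom_poly N m) e = (if e \<in> monomials_of_degree N m then 1 else 0)"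
  by (simp add: hom_poly_def lookup_sum lookup_single when_def finite_monomials_of_degree)

lemma hom_poly_0: "hom_poly N 0 = 1"
proof -
  have "monomials_of_degree N 0 = {0}"
    using monomials_of_degree_eq_zero[of N 0]
    by (auto simp: monomials_of_degree_def monomials_def)
  then show ?thesis by (simp add: hom_poly_def)
qed

lemma hom_poly_no_vars: "hom_poly 0 (Suc n) = 0"
proof -
  have "monomials_of_degree 0 (Suc n) = {}"
    by (auto simp: monomials_of_degree_def)
  then show ?thesis by (simp add: hom_poly_def)
qed

text \<open>Monomials are separated according to whether they contain the last variable; this is the factorization
  \<open>hom_series_Suc\<close> of the generating function, read coefficientwise.\<close>

lemma hom_poly_Suc:
  "hom_poly (Suc N) (Suc n) = hom_poly N (Suc n) + X N * hom_poly (Suc N) n"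
proof -
  have "Poly_Mapping.single N 1 + e \<notin> monomials_of_degree N (Suc n)" for e
  proof -
    have "N \<in> Poly_Mapping.keys (Poly_Mapping.single N 1 + e)"
      by (simp add: in_keys_iff lookup_add)
    then show ?thesis by (auto simp: monomials_of_degree_def monomials_def)
  qed
  then have disj: "monomials_of_degree N (Suc n) \<inter>
      (\<lambda>e. Poly_Mapping.single N 1 + e) ` monomials_of_degree (Suc N) n = {}"
    by blast
  have inj: "inj_on (\<lambda>e. Poly_Mapping.single N 1 + e) (monomials_of_degree (Suc N) n)"
    by (auto intro: inj_onI)
  show ?thesis
    unfolding hom_poly_def monomials_of_degree_Suc
    by (simp add: sum.union_disjoint[OF _ _ disj] finite_monomials_of_degree sum.reindex[OF inj]
        mult_single sum_distrib_left del: One_nat_def)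
qed

definition hom_series :: "nat \<Rightarrow> mpolynomial fps" where
  "hom_series N = Abs_fps (hom_poly N)"

text \<open>The signed elementary symmetric polynomials of the variables in \<open>A\<close>, as the
  coefficients of this product.\<close>

definition elem_series :: "nat set \<Rightarrow> mpolynomial fps" where
  "elem_series A = (\<Prod>i\<in>A. 1 - fps_const (X i) * fps_X)"

lemma hom_series_Suc: "hom_series (Suc N) * (1 - fps_const (X N) * fps_X) = hom_series N"
proof (rule fps_ext)
  fix n
  show "fps_nth (hom_series (Suc N) * (1 - fps_const (X N) * fps_X)) n = fps_nth (hom_series N) n"
  proof (cases n)
    case 0
    then show ?thesis by (simp add: hom_series_def hom_poly_0)
  next
    case (Suc m)
    have "hom_series (Suc N) * (1 - fps_const (X N) * fps_X) =
        hom_series (Suc N) - fps_const (X N) * (fps_X * hom_series (Suc N))"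
      by (simp add: algebra_simps)
    then show ?thesis using Suc by (simp add: hom_series_def hom_poly_Suc)
  qed
qed

lemma hom_series_inverse: "hom_series N * elem_series {..<N} = 1"
proof (induction N)
  case 0
  have "hom_series 0 = 1"
    by (rule fps_ext) (auto simp: hom_series_def hom_poly_0 hom_poly_no_vars gr0_conv_Suc)
  then show ?case by (simp add: elem_series_def)
next
  case (Suc N)
  have "elem_series {..<Suc N} = (1 - fps_const (X N) * fps_X) * elem_series {..<N}"
    by (simp add: elem_series_def lessThan_Suc)
  then show ?case using Suc hom_series_Suc[of N] by (simp flip: mult.assoc)
qed

lemma elem_series_nth_0: "finite A \<Longrightarrow> fps_nth (elem_series A) 0 = 1"
  by (induction rule: finite_induct) (auto simp: elem_series_def)

lemma elem_series_insert_nth: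
  assumes "finite A" "i \<notin> A"
  shows "fps_nth (elem_series (insert i A)) (Suc n) =
    fps_nth (elem_series A) (Suc n) - X i * fps_nth (elem_series A) n"
proof -
  have "elem_series (insert i A) = elem_series A - fps_const (X i) * (fps_X * elem_series A)"
    using assms by (simp add: elem_series_def algebra_simps)
  then show ?thesis by simp
qed

lemma elem_series_nth_gt: "finite A \<Longrightarrow> n > card A \<Longrightarrow> fps_nth (elem_series A) n = 0"
proof (induction A arbitrary: n rule: finite_induct)
  case empty
  then show ?case by (simp add: elem_series_def)
next
  case (insert x F)
  then obtain n' where "n = Suc n'" "n' > card F" by (cases n) auto
  then show ?case using insert by (simp add: elem_series_insert_nth)
qed

lemma elem_series_nth_card:
  "finite A \<Longrightarrow> fps_nth (elem_series A) (card A) = (-1) ^ card A * (\<Prod>i\<in>A. X i)"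
proof (induction A rule: finite_induct)
  case empty
  then show ?case by (simp add: elem_series_def)
next
  case (insert x F)
  then show ?case by (simp add: elem_series_insert_nth elem_series_nth_gt algebra_simps)
qed

text \<open>The coefficients of \<open>hom_series_inverse\<close> in positive degree: the linear recurrence that makes the
  periodicity of the \<open>h\<^sub>j\<close> modulo the fusion ideal propagate.\<close>

lemma elem_series_recurrence:
  "(\<Sum>i\<le>Suc n. fps_nth (elem_series {..<N}) i * hom_poly N (Suc n - i)) = 0"
proof -
  have "(\<Sum>i\<le>Suc n. fps_nth (elem_series {..<N}) i * hom_poly N (Suc n - i)) =
      fps_nth (elem_series {..<N} * hom_series N) (Suc n)"
    by (simp only: fps_mult_nth hom_series_def atLeast0AtMost) simp
  also have "\<dots> = 0" using hom_series_inverse[of N] by (simp add: mult.commute)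
  finally show ?thesis .
qed

text \<open>Cancelling all factors but one in \<open>hom_series_inverse\<close> leaves the geometric series of one variable.
  This is what connects complete homogeneous polynomials to powers of variables, and thereby Jacobi-Trudi
  determinants to alternants.\<close>

lemma power_X_eq_sum:
  assumes "k < N"
  shows "(\<Sum>i\<le>a. fps_nth (elem_series ({..<N} - {k})) i * hom_poly N (a - i)) = X k ^ a"
proof -
  define G :: "mpolynomial fps" where "G = Abs_fps (\<lambda>n. X k ^ n)"
  let ?E = "elem_series ({..<N} - {k})" and ?L = "1 - fps_const (X k) * fps_X"
  have "elem_series {..<N} = ?L * ?E"
    using assms by (simp add: elem_series_def prod.remove[of _ k])
  then have 1: "hom_series N * (?L * ?E) = 1" using hom_series_inverse[of N] by simp
  have L: "?L * G = G - fps_const (X k) * (fps_X * G)" by (simp add: algebra_simps)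
  have 2: "?L * G = 1"
  proof (rule fps_ext)
    fix n show "fps_nth (?L * G) n = fps_nth 1 n"
      unfolding L by (cases n) (simp_all add: G_def)
  qed
  have "?E * hom_series N = (?E * hom_series N) * (?L * G)" using 2 by simp
  also have "\<dots> = G * (hom_series N * (?L * ?E))" by (simp only: ac_simps)
  also have "\<dots> = G" using 1 by simp
  finally have "fps_nth (?E * hom_series N) a = X k ^ a" by (simp add: G_def)
  then show ?thesis
    by (simp only: fps_mult_nth hom_series_def atLeast0AtMost) simp
qed

section \<open>The ring of symmetric polynomials\<close>

text \<open>Reduces an identity that is additive in a polynomial to monomials.\<close>

lemma poly_mapping_add_induct [case_names single add]:
  fixes p :: "'a \<Rightarrow>\<^sub>0 'b::comm_monoid_add"
  assumes "\<And>e c. P (Poly_Mapping.single e c)" "\<And>p q. P p \<Longrightarrow> P q \<Longrightarrow> P (p + q)"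
  shows "P p"
proof -
  have "P (\<Sum>e\<in>A. Poly_Mapping.single e (Poly_Mapping.lookup p e))" if "finite A" for A
    using that
  proof (induction A rule: finite_induct)
    case empty
    then show ?case using assms(1)[of undefined 0] by simp
  qed (simp add: assms)
  moreover have "p = (\<Sum>e\<in>Poly_Mapping.keys p. Poly_Mapping.single e (Poly_Mapping.lookup p e))"
    by (rule poly_mapping_eqI) (simp add: lookup_sum lookup_single when_def in_keys_iff)
  ultimately show ?thesis using finite_keys[of p] by metis
qed

text \<open>An additive bijection of exponent vectors induces a ring automorphism of the polynomials. For
  permutations of variables it shows that symmetric polynomials are closed under products.\<close>

lemma map_key_mult:
  fixes p q :: "'a::comm_monoid_add \<Rightarrow>\<^sub>0 'b::comm_ring_1"
  assumes "bij f" and add: "\<And>a b. f (a + b) = f a + f b"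
  shows "Poly_Mapping.map_key f (p * q) = Poly_Mapping.map_key f p * Poly_Mapping.map_key f q"
proof -
  have inj: "inj f" and surj: "surj f" using assms(1) by (auto simp: bij_def)
  have s: "Poly_Mapping.map_key f (Poly_Mapping.single e c) = Poly_Mapping.single (inv_into UNIV f e) c"
    for e and c :: 'b
    using map_key_single[OF inj, of "inv_into UNIV f e" c] surj by (simp add: surj_f_inv_f)
  have ia: "inv_into UNIV f (a + b) = inv_into UNIV f a + inv_into UNIV f b" for a b
  proof (rule inv_f_eq[OF inj])
    show "f (inv_into UNIV f a + inv_into UNIV f b) = a + b" using surj by (simp add: add surj_f_inv_f)
  qed
  show ?thesis
  proof (induction p arbitrary: q rule: poly_mapping_add_induct)
    case (single e c)
    show ?case
      by (induction q rule: poly_mapping_add_induct)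
        (simp_all add: mult_single s ia map_key_plus[OF inj] ring_distribs)
  next
    case (add p1 p2)
    then show ?case by (simp add: map_key_plus[OF inj] ring_distribs)
  qed
qed

lemma bij_map_key:
  assumes "bij s"
  shows "bij (Poly_Mapping.map_key s :: monomial \<Rightarrow> monomial)"
proof (rule o_bij)
  have i: "inj s" "inj (inv_into UNIV s)" using assms by (auto simp: bij_def inj_imp_surj_inv surj_imp_inj_inv)
  have c: "s \<circ> inv_into UNIV s = (\<lambda>x. x)" "inv_into UNIV s \<circ> s = (\<lambda>x. x)"
    using assms by (auto simp: fun_eq_iff bij_def surj_f_inv_f)
  show "Poly_Mapping.map_key (inv_into UNIV s) \<circ> Poly_Mapping.map_key s = (id :: monomial \<Rightarrow> monomial)"
    "Poly_Mapping.map_key s \<circ> Poly_Mapping.map_key (inv_into UNIV s) = (id :: monomial \<Rightarrow> monomial)"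
    by (rule ext, simp only: comp_apply id_apply map_key_compose[OF i(2,1)]
        map_key_compose[OF i(1,2)] c map_key_id)+
qed

text \<open>The action of a permutation of the variables; symmetric polynomials are its fixed points.\<close>

definition permute_vars :: "(nat \<Rightarrow> nat) \<Rightarrow> mpolynomial \<Rightarrow> mpolynomial" where
  "permute_vars s = Poly_Mapping.map_key (Poly_Mapping.map_key s)"

lemma
  assumes "s permutes {..<N}"
  shows lookup_permute_vars:
      "Poly_Mapping.lookup (permute_vars s p) e = Poly_Mapping.lookup p (Poly_Mapping.map_key s e)"
    and permute_vars_add: "permute_vars s (p + q) = permute_vars s p + permute_vars s q"
    and permute_vars_mult: "permute_vars s (p * q) = permute_vars s p * permute_vars s q"
proof -
  have b: "bij s" using assms by (rule permutes_bij)
  have b': "bij (Poly_Mapping.map_key s :: monomial \<Rightarrow> monomial)" by (rule bij_map_key[OF b])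
  show "Poly_Mapping.lookup (permute_vars s p) e = Poly_Mapping.lookup p (Poly_Mapping.map_key s e)"
    unfolding permute_vars_def using b' by (simp add: Poly_Mapping.map_key.rep_eq bij_is_inj)
  show "permute_vars s (p + q) = permute_vars s p + permute_vars s q"
    unfolding permute_vars_def by (rule map_key_plus[OF bij_is_inj[OF b']])
  show "permute_vars s (p * q) = permute_vars s p * permute_vars s q"
    unfolding permute_vars_def
    by (rule map_key_mult[OF b']) (rule map_key_plus[OF bij_is_inj[OF b]])
qed

lemma symmetric_polys_iff:
  "p \<in> symmetric_polys N \<longleftrightarrow>
     Poly_Mapping.keys p \<subseteq> monomials N \<and> (\<forall>s. s permutes {..<N} \<longrightarrow> permute_vars s p = p)"
  unfolding symmetric_polys_def by (auto simp: poly_mapping_eq_iff fun_eq_iff lookup_permute_vars)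

lemma monomials_add: "a \<in> monomials N \<Longrightarrow> b \<in> monomials N \<Longrightarrow> a + b \<in> monomials N"
  using keys_add[of a b] by (auto simp: monomials_def)

lemma symmetric_polys_add:
  "p \<in> symmetric_polys N \<Longrightarrow> q \<in> symmetric_polys N \<Longrightarrow> p + q \<in> symmetric_polys N"
  using keys_add[of p q] by (auto simp: symmetric_polys_iff permute_vars_add)

lemma symmetric_polys_mult:
  "p \<in> symmetric_polys N \<Longrightarrow> q \<in> symmetric_polys N \<Longrightarrow> p * q \<in> symmetric_polys N"
  using keys_mult[of p q] by (fastforce simp: symmetric_polys_iff permute_vars_mult intro: monomials_add)

lemma symmetric_polys_uminus: "p \<in> symmetric_polys N \<Longrightarrow> - p \<in> symmetric_polys N"
  by (auto simp: symmetric_polys_def in_keys_iff subset_iff)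

lemma symmetric_polys_diff:
  "p \<in> symmetric_polys N \<Longrightarrow> q \<in> symmetric_polys N \<Longrightarrow> p - q \<in> symmetric_polys N"
  using symmetric_polys_add[of p N "- q"] symmetric_polys_uminus by simp

lemma map_key_eq_0_iff:
  assumes "s permutes A"
  shows "Poly_Mapping.map_key s (e::monomial) = 0 \<longleftrightarrow> e = 0"
proof -
  have "inj s" using assms by (simp add: permutes_inj)
  then have "Poly_Mapping.map_key s 0 = (0::monomial)" by simp
  moreover have "inj (Poly_Mapping.map_key s :: monomial \<Rightarrow> monomial)"
    using bij_map_key[OF permutes_bij[OF assms]] by (rule bij_is_inj)
  ultimately show ?thesis by (metis injD)
qed

lemma symmetric_polys_const: "const_poly c \<in> symmetric_polys N"
proof -
  have "0 \<in> monomials N" by (simp add: monomials_def)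
  then show ?thesis
    unfolding symmetric_polys_def const_poly_def
    by (auto simp: lookup_single when_def map_key_eq_0_iff eq_commute[of 0])
qed

lemma symmetric_polys_0: "0 \<in> symmetric_polys N" and symmetric_polys_1: "1 \<in> symmetric_polys N"
  using symmetric_polys_const[of 0 N] symmetric_polys_const[of 1 N] by (simp_all add: const_poly_def)

lemma symmetric_polys_sum:
  "(\<And>i. i \<in> A \<Longrightarrow> f i \<in> symmetric_polys N) \<Longrightarrow> sum f A \<in> symmetric_polys N"
  by (induction A rule: infinite_finite_induct) (auto intro: symmetric_polys_0 symmetric_polys_add)

lemma symmetric_polys_prod:
  "(\<And>i. i \<in> A \<Longrightarrow> f i \<in> symmetric_polys N) \<Longrightarrow> prod f A \<in> symmetric_polys N"
  by (induction A rule: infinite_finite_induct) (auto intro: symmetric_polys_1 symmetric_polys_mult)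

lemma symmetric_polys_power: "p \<in> symmetric_polys N \<Longrightarrow> p ^ n \<in> symmetric_polys N"
  by (induction n) (auto intro: symmetric_polys_1 symmetric_polys_mult)

lemma symmetric_polys_signof: "signof s \<in> symmetric_polys N"
  by (auto simp: sign_def symmetric_polys_1 symmetric_polys_uminus)

lemma symmetric_polys_det:
  assumes "\<And>i j. i < n \<Longrightarrow> j < n \<Longrightarrow> f (i, j) \<in> symmetric_polys N"
  shows "det (mat n n f) \<in> symmetric_polys N"
proof -
  have "(\<Prod>i = 0..<n. mat n n f $$ (i, s i)) \<in> symmetric_polys N" if "s permutes {0..<n}" for s
    using assms permutes_in_image[OF that] by (intro symmetric_polys_prod) auto
  then show ?thesis
    by (subst det_def'[of _ n])
      (auto intro!: symmetric_polys_sum symmetric_polys_mult symmetric_polys_signof)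
qed

lemma symmetric_polys_hom_poly: "hom_poly N m \<in> symmetric_polys N"
proof -
  have key: "Poly_Mapping.map_key s e \<in> monomials_of_degree N m \<longleftrightarrow> e \<in> monomials_of_degree N m"
    if s: "s permutes {..<N}" for s e
  proof -
    have inj: "inj s" using s by (rule permutes_inj)
    have l: "Poly_Mapping.lookup (Poly_Mapping.map_key s e) i = Poly_Mapping.lookup e (s i)" for i
      using inj by (simp add: Poly_Mapping.map_key.rep_eq)
    have "s -` Poly_Mapping.keys e \<subseteq> {..<N} \<longleftrightarrow> Poly_Mapping.keys e \<subseteq> {..<N}"
      using permutes_in_image[OF s] permutes_surj[OF s] unfolding subset_iff vimage_eq
      by (metis surj_f_inv_f)
    moreover have "(\<Sum>i<N. Poly_Mapping.lookup e (s i)) = (\<Sum>i<N. Poly_Mapping.lookup e i)"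
      using sum.permute[OF s, of "Poly_Mapping.lookup e"] by (simp add: comp_def)
    ultimately show ?thesis
      by (simp add: monomials_of_degree_def monomials_def keys_map_key[OF inj] l)
  qed
  have "Poly_Mapping.keys (hom_poly N m) \<subseteq> monomials N"
    by (auto simp: in_keys_iff lookup_hom_poly monomials_of_degree_def split: if_splits)
  then show ?thesis by (auto simp: symmetric_polys_def lookup_hom_poly key)
qed

lemma symmetric_polys_complete_homogeneous: "complete_homogeneous N m \<in> symmetric_polys N"
  by (simp add: complete_homogeneous_eq symmetric_polys_0 symmetric_polys_hom_poly)

text \<open>The recurrence expresses these coefficients by the complete homogeneous polynomials, which are
  symmetric.\<close>

lemma symmetric_polys_elem_series: "fps_nth (elem_series {..<N}) n \<in> symmetric_polys N"
proof (induction n rule: less_induct)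
  case (less n)
  show ?case
  proof (cases n)
    case 0
    then show ?thesis by (simp add: elem_series_nth_0 symmetric_polys_1)
  next
    case (Suc m)
    have "fps_nth (elem_series {..<N}) n =
        - (\<Sum>i\<le>m. fps_nth (elem_series {..<N}) i * hom_poly N (n - i))"
      using elem_series_recurrence[of N m] Suc by (simp add: hom_poly_0 eq_neg_iff_add_eq_0 add.commute)
    then show ?thesis using less Suc
      by (auto intro!: symmetric_polys_uminus symmetric_polys_sum symmetric_polys_mult
          symmetric_polys_hom_poly)
  qed
qed

section \<open>Jacobi-Trudi determinants and alternants\<close>

text \<open>The exponents \<open>a i\<close> are the parts of a partition shifted by \<open>staircase\<close>; in this indexing
  a permutation of the rows is a permutation of the exponents.\<close>

definition jacobi_trudi :: "nat \<Rightarrow> (nat \<Rightarrow> nat) \<Rightarrow> mpolynomial" where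
  "jacobi_trudi N a = det (mat N N (\<lambda>(i, j). complete_homogeneous N (int (a i) - int N + 1 + int j)))"

definition alternant :: "nat \<Rightarrow> (nat \<Rightarrow> nat) \<Rightarrow> mpolynomial" where
  "alternant N a = det (mat N N (\<lambda>(i, j). X j ^ a i))"

definition staircase :: "nat \<Rightarrow> nat \<Rightarrow> nat" where
  "staircase N i = N - 1 - i"

lemma schur_eq_jacobi_trudi: "schur N mu = jacobi_trudi N (\<lambda>i. mu ! i + staircase N i)"
  unfolding schur_def jacobi_trudi_def
  by (intro arg_cong[of _ _ det] cong_mat)
    (auto simp: staircase_def of_nat_diff intro!: arg_cong[of _ _ "complete_homogeneous N"])

lemma symmetric_polys_jacobi_trudi: "jacobi_trudi N a \<in> symmetric_polys N"
  unfolding jacobi_trudi_def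
  by (intro symmetric_polys_det) (simp add: symmetric_polys_complete_homogeneous)

lemma jacobi_trudi_cong: "(\<And>i. i < N \<Longrightarrow> a i = b i) \<Longrightarrow> jacobi_trudi N a = jacobi_trudi N b"
  unfolding jacobi_trudi_def by (intro arg_cong[of _ _ det] cong_mat) auto

lemma jacobi_trudi_staircase: "jacobi_trudi N (staircase N) = 1"
proof -
  let ?A = "mat N N (\<lambda>(i, j). complete_homogeneous N (int (staircase N i) - int N + 1 + int j))"
  have e: "?A $$ (i, j) = (if j < i then 0 else complete_homogeneous N (int (j - i)))"
    if "i < N" "j < N" for i j
    using that by (auto simp: staircase_def of_nat_diff complete_homogeneous_eq
        intro!: arg_cong[of _ _ "hom_poly N"])
  have "det ?A = prod_list (diag_mat ?A)"
    by (rule det_upper_triangular[of _ N]) (use e in \<open>auto simp: upper_triangular_def\<close>)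
  also have "diag_mat ?A = replicate N 1"
    by (rule nth_equalityI) (use e in \<open>auto simp: diag_mat_def complete_homogeneous_eq hom_poly_0\<close>)
  finally show ?thesis by (simp add: jacobi_trudi_def)
qed

text \<open>Rows of the Jacobi-Trudi matrix become rows of the alternant when multiplied by a fixed matrix of
  elementary symmetric polynomials, which does not depend on the exponents.\<close>

lemma jacobi_trudi_mult_matrix:
  assumes "k < N"
  shows "(\<Sum>j<N. complete_homogeneous N (int a - int N + 1 + int j) *
      fps_nth (elem_series ({..<N} - {k})) (N - 1 - j)) = X k ^ a"
proof -
  let ?p = "fps_nth (elem_series ({..<N} - {k}))"
  let ?f = "\<lambda>l. ?p l * complete_homogeneous N (int a - int l)"
  have "(\<Sum>j<N. complete_homogeneous N (int a - int N + 1 + int j) * ?p (N - 1 - j)) = (\<Sum>l<N. ?f l)"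
    by (subst sum.nat_diff_reindex[symmetric], intro sum.cong)
      (auto simp: of_nat_diff mult.commute algebra_simps)
  also have "\<dots> = (\<Sum>l\<le>a + N. ?f l)"
  proof (rule sum.mono_neutral_left)
    show "\<forall>l\<in>{..a + N} - {..<N}. ?f l = 0"
      using assms by (auto simp: elem_series_nth_gt)
  qed auto
  also have "\<dots> = (\<Sum>l\<le>a. ?f l)"
    by (rule sum.mono_neutral_right) (auto simp: complete_homogeneous_eq)
  also have "\<dots> = (\<Sum>l\<le>a. ?p l * hom_poly N (a - l))"
    by (intro sum.cong) (auto simp: complete_homogeneous_eq nat_diff_distrib)
  also have "\<dots> = X k ^ a" by (rule power_X_eq_sum[OF assms])
  finally show ?thesis .
qed

text \<open>The bialternant formula. The determinant of the matrix in \<open>jacobi_trudi_mult_matrix\<close> is found by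
  taking the staircase for \<open>a\<close>, where the Jacobi-Trudi matrix is unitriangular.\<close>

theorem jacobi_trudi_mult_alternant:
  "jacobi_trudi N a * alternant N (staircase N) = alternant N a"
proof -
  define M where "M = mat N N (\<lambda>(j, k). fps_nth (elem_series ({..<N} - {k})) (N - 1 - j))"
  have *: "jacobi_trudi N b * det M = alternant N b" for b
  proof -
    let ?A = "mat N N (\<lambda>(i, j). complete_homogeneous N (int (b i) - int N + 1 + int j))"
    have "?A * M = mat N N (\<lambda>(i, j). X j ^ b i)"
      using jacobi_trudi_mult_matrix[of _ N]
      by (intro eq_matI) (auto simp: M_def scalar_prod_def simp flip: lessThan_atLeast0)
    moreover have "det (?A * M) = det ?A * det M"
      by (rule det_mult) (auto simp: M_def)
    ultimately show ?thesis by (simp add: jacobi_trudi_def alternant_def)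
  qed
  then have "alternant N (staircase N) = det M"
    using jacobi_trudi_staircase[of N] by (metis mult_1)
  then show ?thesis using * by simp
qed

text \<open>The monomial with exponent \<open>a i\<close> at the variable \<open>s i\<close>, which occurs in the Leibniz expansion of
  the alternant at the permutation \<open>s\<close>.\<close>

definition perm_monomial :: "nat \<Rightarrow> (nat \<Rightarrow> nat) \<Rightarrow> (nat \<Rightarrow> nat) \<Rightarrow> monomial" where
  "perm_monomial N s a = (\<Sum>i<N. Poly_Mapping.single (s i) (a i))"

lemma power_X: "X j ^ n = Poly_Mapping.single (Poly_Mapping.single j n) 1"
  by (induction n) (simp_all add: mult_single flip: single_add)

lemma prod_single_1:
  "(\<Prod>i\<in>A. Poly_Mapping.single (f i) (1::rat)) = Poly_Mapping.single (\<Sum>i\<in>A. f i :: monomial) 1"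
  by (induction A rule: infinite_finite_induct) (simp_all add: mult_single)

lemma alternant_eq_sum:
  "alternant N a =
     (\<Sum>s | s permutes {..<N}. signof s * Poly_Mapping.single (perm_monomial N s a) 1)"
proof -
  have "(\<Prod>i<N. mat N N (\<lambda>(i, j). X j ^ a i) $$ (i, s i)) = Poly_Mapping.single (perm_monomial N s a) 1"
    if "s permutes {..<N}" for s
  proof -
    have "(\<Prod>i<N. mat N N (\<lambda>(i, j). X j ^ a i) $$ (i, s i)) = (\<Prod>i<N. X (s i) ^ a i)"
      using permutes_in_image[OF that] by (intro prod.cong) auto
    then show ?thesis by (simp add: power_X prod_single_1 perm_monomial_def del: One_nat_def)
  qed
  then show ?thesis
    unfolding alternant_def
    by (subst det_def'[of _ N]) (auto intro!: sum.cong simp flip: lessThan_atLeast0)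
qed

lemma lookup_perm_monomial:
  assumes "s permutes {..<N}"
  shows "Poly_Mapping.lookup (perm_monomial N s a) (s i) = (if i < N then a i else 0)"
proof -
  have "inj s" using assms by (rule permutes_inj)
  then show ?thesis
    by (simp add: perm_monomial_def lookup_sum lookup_single when_def inj_eq)
qed

lemma perm_monomial_add:
  "perm_monomial N s (\<lambda>i. a i + b i) = perm_monomial N s a + perm_monomial N s b"
  by (simp add: perm_monomial_def single_add sum.distrib)

definition compositions :: "nat \<Rightarrow> nat \<Rightarrow> (nat \<Rightarrow> nat) set" where
  "compositions N m = {d. (\<forall>i\<ge>N. d i = 0) \<and> (\<Sum>i<N. d i) = m}"

lemma bij_betw_perm_monomial:
  assumes s: "s permutes {..<N}"
  shows "bij_betw (perm_monomial N s) (compositions N m) (monomials_of_degree N m)"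
proof (rule bij_betwI[where g = "\<lambda>e i. Poly_Mapping.lookup e (s i)"])
  have mem: "s i < N \<longleftrightarrow> i < N" for i using permutes_in_image[OF s, of i] by simp
  have deg: "(\<Sum>i<N. Poly_Mapping.lookup e (s i)) = (\<Sum>i<N. Poly_Mapping.lookup e i)" for e
    using sum.permute[OF s, of "Poly_Mapping.lookup e"] by (simp add: comp_def)
  show "perm_monomial N s \<in> compositions N m \<rightarrow> monomials_of_degree N m"
  proof
    fix d assume d: "d \<in> compositions N m"
    have "j < N" if j: "j \<in> Poly_Mapping.keys (perm_monomial N s d)" for j
    proof -
      obtain i where i: "j = s i" using permutes_surj[OF s] by (metis surjD)
      show ?thesis using j by (auto simp: i in_keys_iff lookup_perm_monomial[OF s] mem split: if_splits)
    qed
    then show "perm_monomial N s d \<in> monomials_of_degree N m"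
      using d deg[of "perm_monomial N s d"]
      by (auto simp: monomials_of_degree_def monomials_def compositions_def lookup_perm_monomial[OF s])
  qed
  show "(\<lambda>e i. Poly_Mapping.lookup e (s i)) \<in> monomials_of_degree N m \<rightarrow> compositions N m"
  proof
    fix e assume e: "e \<in> monomials_of_degree N m"
    have "Poly_Mapping.lookup e (s i) = 0" if "i \<ge> N" for i
    proof -
      have "s i \<notin> Poly_Mapping.keys e"
        using e that mem[of i] by (auto simp: monomials_of_degree_def monomials_def)
      then show ?thesis by (simp add: in_keys_iff)
    qed
    then show "(\<lambda>i. Poly_Mapping.lookup e (s i)) \<in> compositions N m"
      using e deg[of e] by (simp add: compositions_def monomials_of_degree_def)
  qed
  show "(\<lambda>i. Poly_Mapping.lookup (perm_monomial N s d) (s i)) = d" if "d \<in> compositions N m" for d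
    using that by (auto simp: fun_eq_iff lookup_perm_monomial[OF s] compositions_def)
  show "perm_monomial N s (\<lambda>i. Poly_Mapping.lookup e (s i)) = e" if "e \<in> monomials_of_degree N m" for e
  proof (rule poly_mapping_eqI)
    fix j
    obtain i where i: "j = s i" using permutes_surj[OF s] by (metis surjD)
    have "s i \<notin> Poly_Mapping.keys e" if "\<not> i < N"
      using \<open>e \<in> monomials_of_degree N m\<close> that mem[of i]
      by (auto simp: monomials_of_degree_def monomials_def)
    then show "Poly_Mapping.lookup (perm_monomial N s (\<lambda>i. Poly_Mapping.lookup e (s i))) j =
        Poly_Mapping.lookup e j"
      by (auto simp: i lookup_perm_monomial[OF s] in_keys_iff)
  qed
qed

lemma finite_compositions: "finite (compositions N m)"
  using bij_betw_finite[OF bij_betw_perm_monomial[OF permutes_id]] finite_monomials_of_degree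
  by blast

text \<open>As \<open>hom_poly N m\<close> is symmetric, its monomials can be indexed separately for each permutation \<open>s\<close> so
  that they add directly to the exponents of the term at \<open>s\<close>.\<close>

lemma hom_poly_mult_alternant:
  "hom_poly N m * alternant N a = (\<Sum>d\<in>compositions N m. alternant N (\<lambda>i. a i + d i))"
proof -
  have "hom_poly N m * alternant N a =
      (\<Sum>s | s permutes {..<N}. \<Sum>d\<in>compositions N m.
        signof s * Poly_Mapping.single (perm_monomial N s (\<lambda>i. a i + d i)) 1)"
    unfolding alternant_eq_sum sum_distrib_left
  proof (intro sum.cong refl)
    fix s assume "s \<in> {s. s permutes {..<N}}"
    then have s: "s permutes {..<N}" by simp
    have "hom_poly N m = (\<Sum>d\<in>compositions N m. Poly_Mapping.single (perm_monomial N s d) 1)"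
      unfolding hom_poly_def
      by (rule sum.reindex_bij_betw[OF bij_betw_perm_monomial[OF s], symmetric])
    then show "hom_poly N m * (signof s * Poly_Mapping.single (perm_monomial N s a) 1) =
        (\<Sum>d\<in>compositions N m. signof s * Poly_Mapping.single (perm_monomial N s (\<lambda>i. a i + d i)) 1)"
      by (simp add: perm_monomial_add mult_single sum_distrib_left sum_distrib_right ac_simps)
  qed
  also have "\<dots> = (\<Sum>d\<in>compositions N m. alternant N (\<lambda>i. a i + d i))"
    unfolding alternant_eq_sum by (rule sum.swap)
  finally show ?thesis .
qed

lemma prod_X_mult_alternant:
  "(\<Prod>i<N. X i) * alternant N a = alternant N (\<lambda>i. a i + 1)"
  unfolding alternant_eq_sum sum_distrib_left
proof (intro sum.cong refl)
  fix s assume "s \<in> {s. s permutes {..<N}}"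
  then have s: "s permutes {..<N}" by simp
  have "perm_monomial N s (\<lambda>i. 1) = (\<Sum>i<N. Poly_Mapping.single i 1)"
    unfolding perm_monomial_def
    using sum.permute[OF s, of "\<lambda>i. Poly_Mapping.single i 1 :: monomial"] by (simp only: comp_def)
  then have "(\<Prod>i<N. X i) = Poly_Mapping.single (perm_monomial N s (\<lambda>i. 1)) 1"
    by (simp only: prod_single_1)
  then show "(\<Prod>i<N. X i) * (signof s * Poly_Mapping.single (perm_monomial N s a) 1) =
      signof s * Poly_Mapping.single (perm_monomial N s (\<lambda>i. a i + 1)) 1"
    by (simp add: perm_monomial_add mult_single ac_simps del: One_nat_def)
qed

section \<open>Linear functionals invariant under the affine translations\<close>

text \<open>Congruence of exponent vectors modulo the lattice spanned by \<open>(1, \<dots>, 1)\<close> and \<open>n\<close> times the root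
  lattice. Together with the permutations, translations by this lattice generate the affine Weyl group,
  and a translation has sign \<open>+1\<close>.\<close>

definition affine_equiv :: "nat \<Rightarrow> nat \<Rightarrow> monomial \<Rightarrow> monomial \<Rightarrow> bool" where
  "affine_equiv N n e f \<longleftrightarrow> (\<exists>(c::int) m. (\<Sum>i<N. m i) = 0 \<and>
     (\<forall>i<N. int (Poly_Mapping.lookup e i) = int (Poly_Mapping.lookup f i) + c + int n * m i))"

lemma affine_equivI:
  assumes "(\<Sum>i<N. m i) = 0"
    and "\<And>i. i < N \<Longrightarrow> int (Poly_Mapping.lookup e i) = int (Poly_Mapping.lookup f i) + c + int n * m i"
  shows "affine_equiv N n e f"
  unfolding affine_equiv_def using assms by blast

lemma affine_equiv_refl: "affine_equiv N n e e"
  by (rule affine_equivI[where m = "\<lambda>_. 0" and c = 0]) auto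

lemma affine_equiv_sym: "affine_equiv N n e f \<Longrightarrow> affine_equiv N n f e"
  unfolding affine_equiv_def
  by (elim exE conjE, rename_tac c m, rule_tac x = "- c" in exI, rule_tac x = "\<lambda>i. - m i" in exI)
    (auto simp: sum_negf)

lemma affine_equiv_trans:
  assumes "affine_equiv N n e f" "affine_equiv N n f g"
  shows "affine_equiv N n e g"
proof -
  obtain c m where 1: "(\<Sum>i<N. m i) = 0"
    "\<forall>i<N. int (Poly_Mapping.lookup e i) = int (Poly_Mapping.lookup f i) + c + int n * m i"
    using assms(1) unfolding affine_equiv_def by blast
  obtain c' m' where 2: "(\<Sum>i<N. m' i) = 0"
    "\<forall>i<N. int (Poly_Mapping.lookup f i) = int (Poly_Mapping.lookup g i) + c' + int n * m' i"
    using assms(2) unfolding affine_equiv_def by blast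
  show ?thesis
    by (rule affine_equivI[where m = "\<lambda>i. m i + m' i" and c = "c + c'"])
      (use 1 2 in \<open>auto simp: sum.distrib algebra_simps\<close>)
qed

lemma affine_equiv_add: "affine_equiv N n e f \<Longrightarrow> affine_equiv N n (g + e) (g + f)"
  unfolding affine_equiv_def by (simp add: lookup_add algebra_simps)

definition affine_invariant :: "nat \<Rightarrow> nat \<Rightarrow> (monomial \<Rightarrow> rat) \<Rightarrow> bool" where
  "affine_invariant N n \<phi> \<longleftrightarrow> (\<forall>e f. affine_equiv N n e f \<longrightarrow> \<phi> e = \<phi> f)"

definition pairing :: "(monomial \<Rightarrow> rat) \<Rightarrow> mpolynomial \<Rightarrow> rat" where
  "pairing \<phi> p = (\<Sum>e\<in>Poly_Mapping.keys p. Poly_Mapping.lookup p e * \<phi> e)"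

lemma pairing_superset:
  "finite A \<Longrightarrow> Poly_Mapping.keys p \<subseteq> A \<Longrightarrow> pairing \<phi> p = (\<Sum>e\<in>A. Poly_Mapping.lookup p e * \<phi> e)"
  unfolding pairing_def by (rule sum.mono_neutral_left) (auto simp: in_keys_iff)

lemma pairing_add: "pairing \<phi> (p + q) = pairing \<phi> p + pairing \<phi> q"
  using pairing_superset[of "Poly_Mapping.keys p \<union> Poly_Mapping.keys q" _ \<phi>] keys_add[of p q]
  by (simp add: lookup_add sum.distrib algebra_simps)

lemma pairing_0: "pairing \<phi> 0 = 0"
  by (simp add: pairing_def)

lemma pairing_uminus: "pairing \<phi> (- p) = - pairing \<phi> p"
  using pairing_add[of \<phi> p "- p"] by (simp add: pairing_0)

lemma pairing_diff: "pairing \<phi> (p - q) = pairing \<phi> p - pairing \<phi> q"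
  using pairing_add[of \<phi> p "- q"] by (simp add: pairing_uminus)

lemma pairing_sum: "pairing \<phi> (sum f A) = (\<Sum>i\<in>A. pairing \<phi> (f i))"
  by (induction A rule: infinite_finite_induct) (simp_all add: pairing_0 pairing_add)

lemma pairing_single: "pairing \<phi> (Poly_Mapping.single e c) = c * \<phi> e"
  by (simp add: pairing_def)

lemma pairing_single_mult:
  "pairing \<phi> (Poly_Mapping.single e c * p) = c * pairing (\<lambda>f. \<phi> (e + f)) p"
  by (induction p rule: poly_mapping_add_induct)
    (simp_all add: mult_single pairing_single pairing_add ring_distribs)

definition annihilated :: "nat \<Rightarrow> nat \<Rightarrow> mpolynomial \<Rightarrow> bool" where
  "annihilated N n p \<longleftrightarrow> (\<forall>\<phi>. affine_invariant N n \<phi> \<longrightarrow> pairing \<phi> p = 0)"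

lemma annihilated_0: "annihilated N n 0"
  by (simp add: annihilated_def pairing_0)

lemma annihilated_add: "annihilated N n p \<Longrightarrow> annihilated N n q \<Longrightarrow> annihilated N n (p + q)"
  by (simp add: annihilated_def pairing_add)

lemma annihilated_uminus: "annihilated N n p \<Longrightarrow> annihilated N n (- p)"
  by (simp add: annihilated_def pairing_uminus)

text \<open>Multiplication by a monomial shifts the argument of an invariant function, and shifted functions are
  again invariant. Hence the polynomials that all invariant functions annihilate form an ideal.\<close>

lemma annihilated_mult: "annihilated N n p \<Longrightarrow> annihilated N n (q * p)"
proof (induction q rule: poly_mapping_add_induct)
  case (single e c)
  have "affine_invariant N n (\<lambda>f. \<phi> (e + f))" if "affine_invariant N n \<phi>" for \<phi>
    using that by (auto simp: affine_invariant_def affine_equiv_add)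
  then show ?case using single by (simp add: annihilated_def pairing_single_mult)
next
  case (add p q)
  then show ?case by (simp add: ring_distribs annihilated_add)
qed

lemma pairing_alternant:
  "pairing \<phi> (alternant N a) =
     (\<Sum>s | s permutes {..<N}. of_int (sign s) * \<phi> (perm_monomial N s a))"
  unfolding alternant_eq_sum pairing_sum
  by (intro sum.cong refl) (auto simp: sign_def pairing_single pairing_uminus)

text \<open>Translating the exponents by the lattice changes every monomial of the alternant into an equivalent
  one, because permutations of the variables preserve the lattice.\<close>

lemma annihilated_alternant_diff:
  assumes "(\<Sum>i<N. m i) = 0" and "\<And>i. i < N \<Longrightarrow> int (a i) = int (b i) + c + int n * m i"
  shows "annihilated N n (alternant N a - alternant N b)"
proof -
  have "affine_equiv N n (perm_monomial N s a) (perm_monomial N s b)" if s: "s permutes {..<N}" for s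
  proof (rule affine_equivI)
    show "(\<Sum>i<N. m (inv_into UNIV s i)) = 0"
      using sum.permute[OF permutes_inv[OF s], of m] assms(1) by (simp add: comp_def)
    fix j assume "j < N"
    define i where "i = inv_into UNIV s j"
    have j: "j = s i" unfolding i_def using s by (metis permutes_inverses(1))
    have "i < N" using \<open>j < N\<close> permutes_in_image[OF s, of i] j by simp
    then show "int (Poly_Mapping.lookup (perm_monomial N s a) j) =
        int (Poly_Mapping.lookup (perm_monomial N s b) j) + c + int n * m (inv_into UNIV s j)"
      unfolding i_def[symmetric] using assms(2) by (simp add: j lookup_perm_monomial[OF s])
  qed
  then have "pairing \<phi> (alternant N a) = pairing \<phi> (alternant N b)" if "affine_invariant N n \<phi>" for \<phi>
    using that unfolding pairing_alternant affine_invariant_def by (intro sum.cong) auto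
  then show ?thesis by (simp add: annihilated_def pairing_diff)
qed

lemma alternant_permute:
  assumes "s permutes {..<N}"
  shows "alternant N (a \<circ> s) = signof s * alternant N a"
proof -
  let ?A = "mat N N (\<lambda>(i, j). X j ^ a i)"
  have "mat N N (\<lambda>(i, j). ?A $$ (s i, j)) = mat N N (\<lambda>(i, j). X j ^ (a \<circ> s) i)"
    using permutes_in_image[OF assms] by (intro cong_mat) auto
  then show ?thesis
    using det_permute_rows[of ?A N s] assms by (simp add: alternant_def lessThan_atLeast0)
qed

lemma jacobi_trudi_permute:
  assumes "s permutes {..<N}"
  shows "jacobi_trudi N (a \<circ> s) = signof s * jacobi_trudi N a"
proof -
  let ?f = "\<lambda>a (i, j). complete_homogeneous N (int (a i) - int N + 1 + int j)"
  let ?A = "mat N N (?f a)"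
  have "mat N N (\<lambda>(i, j). ?A $$ (s i, j)) = mat N N (?f (a \<circ> s))"
    using permutes_in_image[OF assms] by (intro cong_mat) auto
  then show ?thesis
    using det_permute_rows[of ?A N s] assms by (simp add: jacobi_trudi_def lessThan_atLeast0)
qed

lemma signof_transpose: "i \<noteq> j \<Longrightarrow> signof (transpose i j) = -1"
  by (simp add: sign_swap_id)

lemma transpose_permutes: "i < N \<Longrightarrow> j < N \<Longrightarrow> transpose i j permutes {..<N}"
  by (rule permutes_swap_id) auto

lemma jacobi_trudi_swap:
  "i < N \<Longrightarrow> j < N \<Longrightarrow> i \<noteq> j \<Longrightarrow> jacobi_trudi N (a \<circ> transpose i j) = - jacobi_trudi N a"
  by (simp add: jacobi_trudi_permute transpose_permutes signof_transpose)

lemma alternant_swap: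
  "i < N \<Longrightarrow> j < N \<Longrightarrow> i \<noteq> j \<Longrightarrow> alternant N (a \<circ> transpose i j) = - alternant N a"
  by (simp add: alternant_permute transpose_permutes signof_transpose)

text \<open>On the affine wall the exchange of the first and the last exponent amounts to a lattice translation.
  So the alternant equals its negative for every invariant functional. These are the exponents of the
  Schur polynomials that generate the fusion ideal.\<close>

lemma annihilated_alternant_wall:
  assumes "2 \<le> N" "a 0 = a (N - 1) + n"
  shows "annihilated N n (alternant N a)"
proof -
  let ?m = "\<lambda>i. if i = 0 then -1 else if i = N - 1 then 1 else (0::int)"
  have "(\<Sum>i<N. ?m i) = (\<Sum>i\<in>{0, N - 1}. ?m i)"
    by (rule sum.mono_neutral_right) (use assms(1) in auto)
  also have "\<dots> = 0" using assms(1) by simp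
  finally have "annihilated N n (alternant N (a \<circ> transpose 0 (N - 1)) - alternant N a)"
    by (rule annihilated_alternant_diff[where c = 0]) (use assms in \<open>auto simp: transpose_def\<close>)
  moreover have "alternant N (a \<circ> transpose 0 (N - 1)) = - alternant N a"
    using assms(1) by (intro alternant_swap) auto
  ultimately show ?thesis by (simp add: annihilated_def pairing_diff pairing_uminus)
qed

text \<open>Exponents in the interior of the fundamental alcove, normalized by a vanishing last entry.\<close>

definition alcove :: "nat \<Rightarrow> nat \<Rightarrow> (nat \<Rightarrow> nat) \<Rightarrow> bool" where
  "alcove N n a \<longleftrightarrow> (\<forall>i j. i < j \<longrightarrow> j < N \<longrightarrow> a j < a i) \<and> a 0 < n \<and> a (N - 1) = 0"

lemma alcove_le: "alcove N n a \<Longrightarrow> i < N \<Longrightarrow> a i < n"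
  unfolding alcove_def by (cases "i = 0") (auto intro: less_trans)

lemma permutes_strict_mono_id:
  fixes s :: "nat \<Rightarrow> nat"
  assumes "s permutes {..<N}" and "\<And>i j. i < j \<Longrightarrow> j < N \<Longrightarrow> s i < s j"
  shows "s = id"
proof -
  have "i < N \<Longrightarrow> i \<le> s i" for i
  proof (induction i)
    case (Suc i)
    then show ?case using assms(2)[of i "Suc i"] by simp
  qed simp
  then show ?thesis using permutes_natset_ge[OF assms(1)] by auto
qed

text \<open>The fundamental alcove is a strict fundamental domain. If \<open>s\<close> maps \<open>a\<close> to \<open>b\<close> up to a translation by
  \<open>c + n m\<close>, then two entries of \<open>m\<close> can differ by at most one, since all differences of exponents
  are less than \<open>n\<close> in absolute value. As \<open>m\<close> has sum zero, it vanishes, and then the order of the exponents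
  forces \<open>s = id\<close>.\<close>

lemma alcove_affine_equiv:
  assumes "2 \<le> N" "alcove N n a" "alcove N n b" "s permutes {..<N}"
    and "affine_equiv N n (perm_monomial N s a) (perm_monomial N id b)"
  shows "s = id \<and> (\<forall>i<N. a i = b i)"
proof -
  obtain c m where m: "(\<Sum>i<N. m i) = 0"
    and eq: "\<And>j. j < N \<Longrightarrow> int (Poly_Mapping.lookup (perm_monomial N s a) j) =
      int (Poly_Mapping.lookup (perm_monomial N id b) j) + c + int n * m j"
    using assms(5) unfolding affine_equiv_def by blast
  have s: "s i < N \<longleftrightarrow> i < N" for i using permutes_in_image[OF assms(4), of i] by simp
  have eq': "int (a i) = int (b (s i)) + c + int n * m (s i)" if "i < N" for i
    using eq[of "s i"] that s lookup_perm_monomial[OF assms(4), of a i]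
      lookup_perm_monomial[OF permutes_id, of N b "s i"] by simp
  have close: "m (s i) \<le> m (s j) + 1" if "i < N" "j < N" for i j
  proof (rule ccontr)
    assume "\<not> ?thesis"
    then have "2 \<le> m (s i) - m (s j)" by simp
    then have "int n * 2 \<le> int n * (m (s i) - m (s j))" by (intro mult_left_mono) auto
    then show False
      using eq'[OF that(1)] eq'[OF that(2)] alcove_le[OF assms(2) that(1)]
        alcove_le[OF assms(3), of "s j"] s[of j] that by (simp add: algebra_simps)
  qed
  have close': "m i \<le> m j + 1" if "i < N" "j < N" for i j
    using close[of "inv_into UNIV s i" "inv_into UNIV s j"] that s
      permutes_inverses(1)[OF assms(4)] by metis
  have pos: "m i \<le> 0" if i: "i < N" for i
  proof (rule ccontr)
    assume "\<not> m i \<le> 0"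
    then have "\<forall>j\<in>{..<N}. 0 \<le> m j" using close'[OF i] by force
    moreover have "0 < m i" using \<open>\<not> m i \<le> 0\<close> by simp
    ultimately have "0 < (\<Sum>j<N. m j)" using i by (intro sum_pos2[of _ i]) auto
    then show False using m by simp
  qed
  have m0: "m i = 0" if "i < N" for i
  proof (rule ccontr)
    assume "m i \<noteq> 0"
    then have "0 < - m i" using pos[OF that] by simp
    then have "0 < (\<Sum>j<N. - m j)" using that pos by (intro sum_pos2[of _ i]) auto
    then show False using m by (simp add: sum_negf)
  qed
  then have eq2: "int (a i) = int (b (s i)) + c" if "i < N" for i using eq'[OF that] that s by simp
  have "s = id"
  proof (rule permutes_strict_mono_id[OF assms(4)])
    fix i j assume ij: "i < j" "j < N"
    then have "b (s j) < b (s i)" using eq2[of i] eq2[of j] assms(2) unfolding alcove_def by fastforce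
    moreover have "b (s i) \<le> b (s j)" if "s j \<le> s i"
      using assms(3) that s[of i] ij unfolding alcove_def
      by (cases "s j = s i") (auto intro: less_imp_le)
    ultimately show "s i < s j" by (meson leI not_le)
  qed
  moreover have "c = 0"
    using eq2[of "N - 1"] assms(1-3) \<open>s = id\<close> by (simp add: alcove_def)
  ultimately show ?thesis using eq2 by simp
qed

definition alcove_indicator :: "nat \<Rightarrow> nat \<Rightarrow> (nat \<Rightarrow> nat) \<Rightarrow> monomial \<Rightarrow> rat" where
  "alcove_indicator N n b e = (if affine_equiv N n e (perm_monomial N id b) then 1 else 0)"

lemma affine_invariant_alcove_indicator: "affine_invariant N n (alcove_indicator N n b)"
  unfolding affine_invariant_def alcove_indicator_def
  by (auto intro: affine_equiv_trans affine_equiv_sym)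

text \<open>Alternants of exponents in the alcove are dual to indicator functions of their own cosets: no term of
  the Leibniz expansion other than the one at \<open>id\<close> lies in the coset.\<close>

lemma pairing_alcove_indicator:
  assumes "2 \<le> N" "alcove N n a" "alcove N n b"
  shows "pairing (alcove_indicator N n b) (alternant N a) = (if \<forall>i<N. a i = b i then 1 else 0)"
proof -
  have z: "alcove_indicator N n b (perm_monomial N s a) = (if s = id \<and> (\<forall>i<N. a i = b i) then 1 else 0)"
    if "s permutes {..<N}" for s
  proof (cases "s = id \<and> (\<forall>i<N. a i = b i)")
    case True
    then have "perm_monomial N s a = perm_monomial N id b"
      by (auto simp: perm_monomial_def)
    then show ?thesis using True by (simp add: alcove_indicator_def affine_equiv_refl)
  next
    case False
    then show ?thesis
      using alcove_affine_equiv[OF assms that] by (auto simp: alcove_indicator_def)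
  qed
  have "pairing (alcove_indicator N n b) (alternant N a) =
      (\<Sum>s | s permutes {..<N}. if s = id then (if \<forall>i<N. a i = b i then 1 else 0) else 0)"
    unfolding pairing_alternant by (intro sum.cong refl) (auto simp: z)
  also have "\<dots> = (if \<forall>i<N. a i = b i then 1 else 0)"
    by (simp add: finite_permutations permutes_id)
  finally show ?thesis .
qed

section \<open>The classical Pieri rule\<close>

lemma alternant_staircase_nonzero:
  assumes "2 \<le> N"
  shows "alternant N (staircase N) \<noteq> 0"
proof
  assume "alternant N (staircase N) = 0"
  moreover have "alcove N N (staircase N)" using assms by (auto simp: alcove_def staircase_def)
  ultimately show False
    using pairing_alcove_indicator[OF assms, of N "staircase N" "staircase N"] by (simp add: pairing_0)
qed

lemma jacobi_trudi_eqI: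
  assumes "2 \<le> N" "p * alternant N (staircase N) = q * alternant N (staircase N)"
  shows "p = q"
  using assms alternant_staircase_nonzero by simp

text \<open>The Pieri rule before any cancellation: horizontal strips are not imposed, and terms that violate
  them vanish or cancel in pairs. It is obtained from alternants by dividing by the Vandermonde alternant.\<close>

theorem pieri_hom_poly:
  assumes "2 \<le> N"
  shows "hom_poly N m * jacobi_trudi N a = (\<Sum>d\<in>compositions N m. jacobi_trudi N (\<lambda>i. a i + d i))"
  by (rule jacobi_trudi_eqI[OF assms])
    (simp add: mult.assoc jacobi_trudi_mult_alternant hom_poly_mult_alternant sum_distrib_right)

lemma jacobi_trudi_shift:
  assumes "2 \<le> N"
  shows "jacobi_trudi N (\<lambda>i. a i + 1) = schur N (replicate N 1) * jacobi_trudi N a"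
proof -
  have *: "jacobi_trudi N (\<lambda>i. b i + 1) = (\<Prod>i<N. X i) * jacobi_trudi N b" for b
    by (rule jacobi_trudi_eqI[OF assms])
      (simp only: mult.assoc jacobi_trudi_mult_alternant prod_X_mult_alternant)
  have "schur N (replicate N 1) = jacobi_trudi N (\<lambda>i. staircase N i + 1)"
    unfolding schur_eq_jacobi_trudi by (rule jacobi_trudi_cong) auto
  then show ?thesis using * by (simp add: jacobi_trudi_staircase)
qed

lemma schur_column: 
  assumes "2 \<le> N"
  shows "schur N (replicate N 1) = (\<Prod>i<N. X i)"
proof (rule jacobi_trudi_eqI[OF assms])
  have "schur N (replicate N 1) = jacobi_trudi N (\<lambda>i. staircase N i + 1)"
    unfolding schur_eq_jacobi_trudi by (rule jacobi_trudi_cong) auto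
  then show "schur N (replicate N 1) * alternant N (staircase N) =
      (\<Prod>i<N. X i) * alternant N (staircase N)"
    by (simp only: jacobi_trudi_mult_alternant prod_X_mult_alternant)
qed

section \<open>Congruence modulo the fusion ideal\<close>

lemma symmetric_ring_simps [simp]:
  "carrier (symmetric_ring N) = symmetric_polys N"
  "x \<otimes>\<^bsub>symmetric_ring N\<^esub> y = x * y" "\<one>\<^bsub>symmetric_ring N\<^esub> = 1"
  "x \<oplus>\<^bsub>symmetric_ring N\<^esub> y = x + y" "\<zero>\<^bsub>symmetric_ring N\<^esub> = 0"
  by (simp_all add: symmetric_ring_def)

lemma cring_symmetric_ring: "cring (symmetric_ring N)"
proof (rule cringI)
  show "abelian_group (symmetric_ring N)"
  proof (rule abelian_groupI)
    fix x assume "x \<in> carrier (symmetric_ring N)"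
    then show "\<exists>y\<in>carrier (symmetric_ring N). y \<oplus>\<^bsub>symmetric_ring N\<^esub> x = \<zero>\<^bsub>symmetric_ring N\<^esub>"
      by (intro bexI[of _ "- x"]) (auto intro: symmetric_polys_uminus)
  qed (auto intro: symmetric_polys_add symmetric_polys_0 simp: ac_simps)
  show "comm_monoid (symmetric_ring N)"
    by (rule comm_monoidI) (auto intro: symmetric_polys_mult symmetric_polys_1 simp: ac_simps)
qed (auto simp: ring_distribs)

lemma symmetric_ring_minus:
  assumes "x \<in> symmetric_polys N"
  shows "\<ominus>\<^bsub>symmetric_ring N\<^esub> x = - x"
proof -
  interpret cring "symmetric_ring N" by (rule cring_symmetric_ring)
  show ?thesis by (rule minus_equality) (use assms in \<open>auto intro: symmetric_polys_uminus\<close>)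
qed

locale fusion_level =
  fixes N k :: nat
  assumes two_le_N: "2 \<le> N"
begin

abbreviation "R \<equiv> symmetric_ring N"
abbreviation "I \<equiv> fusion_ideal N k"
abbreviation "n \<equiv> N + k"
abbreviation "h m \<equiv> complete_homogeneous N m"

definition fcong :: "mpolynomial \<Rightarrow> mpolynomial \<Rightarrow> bool" (infix "\<approx>" 50) where
  "p \<approx> q \<longleftrightarrow> p - q \<in> I"

sublocale R: cring R by (rule cring_symmetric_ring)

lemma generators_symmetric:
  "insert (schur N (replicate N 1) - 1)
     {schur N \<mu> | \<mu>. \<mu> \<in> partitions N \<and> \<mu> ! 0 - \<mu> ! (N - 1) = k + 1} \<subseteq> symmetric_polys N"
  by (auto simp: schur_eq_jacobi_trudi intro: symmetric_polys_jacobi_trudi symmetric_polys_1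
      symmetric_polys_diff)

sublocale I: ideal I R
  unfolding fusion_ideal_def by (rule R.genideal_ideal) (use generators_symmetric in simp)

lemma generators_in_ideal:
  "schur N (replicate N 1) - 1 \<in> I"
  "\<mu> \<in> partitions N \<Longrightarrow> \<mu> ! 0 - \<mu> ! (N - 1) = k + 1 \<Longrightarrow> schur N \<mu> \<in> I"
  using R.genideal_self[of "insert (schur N (replicate N 1) - 1)
     {schur N \<mu> | \<mu>. \<mu> \<in> partitions N \<and> \<mu> ! 0 - \<mu> ! (N - 1) = k + 1}"] generators_symmetric
  unfolding fusion_ideal_def by auto

lemma ideal_zero: "0 \<in> I"
  using I.additive_subgroup_axioms additive_subgroup.zero_closed by fastforce

lemma ideal_add: "p \<in> I \<Longrightarrow> q \<in> I \<Longrightarrow> p + q \<in> I"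
  using I.a_closed by simp

lemma ideal_mult: "q \<in> symmetric_polys N \<Longrightarrow> p \<in> I \<Longrightarrow> q * p \<in> I"
  using I.I_l_closed by simp

lemma ideal_uminus: "p \<in> I \<Longrightarrow> - p \<in> I"
  using ideal_mult[of "-1" p] symmetric_polys_uminus[OF symmetric_polys_1] by simp

lemma ideal_diff: "p \<in> I \<Longrightarrow> q \<in> I \<Longrightarrow> p - q \<in> I"
  using ideal_add[of p "- q"] ideal_uminus by simp

lemma ideal_sum: "(\<And>i. i \<in> A \<Longrightarrow> f i \<in> I) \<Longrightarrow> sum f A \<in> I"
  by (induction A rule: infinite_finite_induct) (auto intro: ideal_zero ideal_add)

lemma ideal_half:
  assumes "p + p \<in> I"
  shows "p \<in> I"
proof -
  have "const_poly (1/2) * (p + p) = (const_poly (1/2) + const_poly (1/2)) * p"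
    by (simp add: algebra_simps)
  also have "\<dots> = p" by (simp add: const_poly_def flip: single_add)
  finally show ?thesis using ideal_mult[OF symmetric_polys_const assms] by metis
qed

lemma fcong_refl: "p \<approx> p" and fcong_eq: "p = q \<Longrightarrow> p \<approx> q"
  by (simp_all add: fcong_def ideal_zero)

lemma fcong_sym: "p \<approx> q \<Longrightarrow> q \<approx> p"
  using ideal_uminus[of "p - q"] by (simp add: fcong_def)

lemma fcong_trans [trans]: "p \<approx> q \<Longrightarrow> q \<approx> r \<Longrightarrow> p \<approx> r"
  using ideal_add[of "p - q" "q - r"] by (simp add: fcong_def)

lemma fcong_0: "p \<approx> 0 \<longleftrightarrow> p \<in> I"
  by (simp add: fcong_def)

lemma fcong_uminus: "p \<approx> q \<Longrightarrow> - p \<approx> - q"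
  using ideal_uminus[of "p - q"] by (simp add: fcong_def)

lemma fcong_sum: "(\<And>i. i \<in> A \<Longrightarrow> f i \<approx> g i) \<Longrightarrow> sum f A \<approx> sum g A"
  using ideal_sum[of A "\<lambda>i. f i - g i"] by (simp add: fcong_def sum_subtractf)

lemma fcong_mult_left: "r \<in> symmetric_polys N \<Longrightarrow> p \<approx> q \<Longrightarrow> r * p \<approx> r * q"
  using ideal_mult[of r "p - q"] by (simp add: fcong_def right_diff_distrib)

lemma fcong_mult:
  assumes "p \<approx> q" "p' \<approx> q'" "p \<in> symmetric_polys N" "q' \<in> symmetric_polys N"
  shows "p * p' \<approx> q * q'"
  using fcong_trans[OF fcong_mult_left[OF assms(3,2)]] fcong_mult_left[OF assms(4,1)]
  by (simp add: mult.commute)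

lemma fcong_prod:
  "(\<And>i. i \<in> A \<Longrightarrow> f i \<approx> g i) \<Longrightarrow> (\<And>i. i \<in> A \<Longrightarrow> f i \<in> symmetric_polys N) \<Longrightarrow>
   (\<And>i. i \<in> A \<Longrightarrow> g i \<in> symmetric_polys N) \<Longrightarrow> prod f A \<approx> prod g A"
proof (induction A rule: infinite_finite_induct)
  case (insert x F)
  then show ?case by (simp add: fcong_mult symmetric_polys_prod)
qed (simp_all add: fcong_refl)

lemma fcong_det:
  assumes "\<And>i j. i < m \<Longrightarrow> j < m \<Longrightarrow> f (i, j) \<approx> g (i, j)"
    and "\<And>i j. i < m \<Longrightarrow> j < m \<Longrightarrow> f (i, j) \<in> symmetric_polys N"
    and "\<And>i j. i < m \<Longrightarrow> j < m \<Longrightarrow> g (i, j) \<in> symmetric_polys N"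
  shows "det (mat m m f) \<approx> det (mat m m g)"
proof -
  have "(\<Prod>i = 0..<m. mat m m f $$ (i, s i)) \<approx> (\<Prod>i = 0..<m. mat m m g $$ (i, s i))"
    if "s permutes {0..<m}" for s
    using permutes_in_image[OF that] assms by (intro fcong_prod) auto
  then show ?thesis
    by (auto simp: det_def'[of _ m] intro!: fcong_sum fcong_mult_left symmetric_polys_signof)
qed

text \<open>Half of the description of the fusion ideal by alternants. It suffices to check generators because the
  polynomials \<open>p\<close> in the conclusion form an ideal of the symmetric polynomials.\<close>

lemma ideal_annihilated:
  assumes "p \<in> I"
  shows "annihilated N n (p * alternant N (staircase N))"
proof -
  define J where "J = {p \<in> symmetric_polys N. annihilated N n (p * alternant N (staircase N))}"
  have "ideal J R"
  proof (rule idealI)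
    show "ring R" by (rule R.ring_axioms)
    have "inv\<^bsub>add_monoid R\<^esub> x = - x" if "x \<in> symmetric_polys N" for x
      using symmetric_ring_minus[OF that] by (simp add: a_inv_def)
    then show "subgroup J (add_monoid R)"
      by unfold_locales (auto simp: J_def symmetric_polys_add symmetric_polys_0 ring_distribs
          annihilated_add annihilated_0 annihilated_uminus symmetric_polys_uminus)
    fix a x assume "a \<in> J" "x \<in> carrier R"
    moreover have "annihilated N n (x * (a * alternant N (staircase N)))" if "a \<in> J"
      by (rule annihilated_mult) (use that in \<open>simp add: J_def\<close>)
    ultimately show "x \<otimes>\<^bsub>R\<^esub> a \<in> J" "a \<otimes>\<^bsub>R\<^esub> x \<in> J"
      by (auto simp: J_def symmetric_polys_mult ac_simps)
  qed
  moreover have "schur N (replicate N 1) - 1 \<in> J"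
  proof -
    have "schur N (replicate N 1) = jacobi_trudi N (\<lambda>i. staircase N i + 1)"
      unfolding schur_eq_jacobi_trudi by (rule jacobi_trudi_cong) auto
    moreover have "annihilated N n (alternant N (\<lambda>i. staircase N i + 1) - alternant N (staircase N))"
      by (rule annihilated_alternant_diff[where m = "\<lambda>_. 0" and c = 1]) auto
    ultimately show ?thesis
      by (auto simp: J_def left_diff_distrib jacobi_trudi_mult_alternant
          intro!: symmetric_polys_diff symmetric_polys_1 symmetric_polys_jacobi_trudi)
  qed
  moreover have "schur N \<mu> \<in> J" if "\<mu> \<in> partitions N" "\<mu> ! 0 - \<mu> ! (N - 1) = k + 1" for \<mu>
  proof -
    have "annihilated N n (alternant N (\<lambda>i. \<mu> ! i + staircase N i))"
      using that(2) two_le_N by (intro annihilated_alternant_wall) (auto simp: staircase_def)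
    then show ?thesis
      by (simp add: J_def schur_eq_jacobi_trudi symmetric_polys_jacobi_trudi jacobi_trudi_mult_alternant)
  qed
  ultimately have "I \<subseteq> J" unfolding fusion_ideal_def by (intro R.genideal_minimal) auto
  then show ?thesis using assms by (auto simp: J_def)
qed

section \<open>Periodicity of the complete homogeneous polynomials\<close>

definition insert_at :: "(nat \<Rightarrow> nat) \<Rightarrow> nat \<Rightarrow> nat \<Rightarrow> nat \<Rightarrow> nat" where
  "insert_at b x s i = (if i < s then b i else if i = s then x else b (i - 1))"

text \<open>Moving an exponent to another position changes the determinant at most by a sign.\<close>

lemma insert_at_ideal:
  assumes "jacobi_trudi N (insert_at b x 0) \<in> I" "s < N"
  shows "jacobi_trudi N (insert_at b x s) \<in> I"
  using assms(2)
proof (induction s)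
  case 0
  then show ?case using assms by simp
next
  case (Suc s)
  have e: "insert_at b x (Suc s) = insert_at b x s \<circ> transpose s (Suc s)"
    by (auto simp: fun_eq_iff insert_at_def transpose_def less_Suc_eq)
  show ?case
    unfolding e using Suc jacobi_trudi_swap[of s N "Suc s" "insert_at b x s"] ideal_uminus
    by (simp del: comp_apply)
qed

text \<open>Up to the order of the rows this is the Schur polynomial of the hook with first row \<open>k + 1\<close> and
  \<open>r\<close> rows. Written in this order, the matrix is unitriangular except for the row \<open>r - 1\<close>.\<close>

lemma hook_ideal:
  assumes "1 \<le> r" "r < N"
  shows "jacobi_trudi N (\<lambda>i. if i = r - 1 then n else staircase N i) \<in> I"
proof -
  define b where "b i = (if i < r - 1 then N - 1 - i else N - 2 - i)" for i
  define \<mu> where "\<mu> = (k + 1) # replicate (r - 1) 1 @ replicate (N - r) 0"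
  have len: "length \<mu> = N" using assms by (simp add: \<mu>_def)
  have nth: "\<mu> ! i = (if i = 0 then k + 1 else if i < r then 1 else 0)" if "i < N" for i
    using that assms by (auto simp: \<mu>_def nth_Cons' nth_append)
  have "sorted_wrt (\<ge>) \<mu>"
    unfolding sorted_wrt_iff_nth_less len
  proof (intro allI impI)
    fix i j assume "i < j" "j < N"
    then have "\<mu> ! i = (if i = 0 then k + 1 else if i < r then 1 else 0)"
      "\<mu> ! j = (if j < r then 1 else 0)"
      using nth[of i] nth[of j] by simp_all
    then show "\<mu> ! j \<le> \<mu> ! i" using \<open>i < j\<close> by simp
  qed
  moreover have "\<mu> ! 0 - \<mu> ! (N - 1) = k + 1" using assms by (auto simp: nth)
  ultimately have "schur N \<mu> \<in> I" using len by (intro generators_in_ideal) (simp_all add: partitions_def)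
  moreover have "schur N \<mu> = jacobi_trudi N (insert_at b n 0)"
    unfolding schur_eq_jacobi_trudi
    by (rule jacobi_trudi_cong) (use assms in \<open>auto simp: nth b_def insert_at_def staircase_def\<close>)
  ultimately have "jacobi_trudi N (insert_at b n (r - 1)) \<in> I"
    using assms insert_at_ideal[of b n "r - 1"] by simp
  moreover have "jacobi_trudi N (insert_at b n (r - 1)) =
      jacobi_trudi N (\<lambda>i. if i = r - 1 then n else staircase N i)"
    by (rule jacobi_trudi_cong) (use assms in \<open>auto simp: b_def insert_at_def staircase_def\<close>)
  ultimately show ?thesis by simp
qed

text \<open>In the Leibniz expansion of the hook determinant of \<open>hook_ideal\<close>, the identity contributes
  \<open>h\<^sub>k\<^sub>+\<^sub>r\<close>. Every other nonzero term has in row \<open>r - 1\<close> a factor \<open>h\<^sub>k\<^sub>+\<^sub>j\<close> with \<open>1 \<le> j < r\<close>, which is in the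
  ideal by induction.\<close>

lemma hom_poly_ideal:
  assumes "1 \<le> r" "r < N"
  shows "hom_poly N (k + r) \<in> I"
  using assms
proof (induction r rule: less_induct)
  case (less r)
  define a where "a i = (if i = r - 1 then n else staircase N i)" for i
  define A where "A = mat N N (\<lambda>(i, j). h (int (a i) - int N + 1 + int j))"
  define trm where "trm s = signof s * (\<Prod>i = 0..<N. A $$ (i, s i))" for s
  have Asym: "A $$ (i, j) \<in> symmetric_polys N" if "i < N" "j < N" for i j
    using that by (simp add: A_def symmetric_polys_complete_homogeneous)
  \<comment> \<open>All rows but \<open>r - 1\<close> are upper triangular, so a nonzero term has \<open>i \<le> s i\<close> for \<open>i \<noteq> r - 1\<close>; if this
    held at \<open>r - 1\<close> as well, \<open>s\<close> would be the identity.\<close>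
  have others: "trm s \<in> I" if s: "s permutes {0..<N}" "s \<noteq> id" for s
  proof -
    have sN: "s i < N \<longleftrightarrow> i < N" for i using permutes_in_image[OF s(1), of i] by simp
    consider i where "i < N" "A $$ (i, s i) = 0" | "\<forall>i<N. A $$ (i, s i) \<noteq> 0" by blast
    then show ?thesis
    proof cases
      case 1
      then have "(\<Prod>i = 0..<N. A $$ (i, s i)) = 0" by (intro prod_zero) auto
      then show ?thesis unfolding trm_def by (simp only: mult_zero_right ideal_zero)
    next
      case 2
      have ge: "i \<le> s i" if "i < N" "i \<noteq> r - 1" for i
      proof (rule ccontr)
        assume "\<not> i \<le> s i"
        then have "int (a i) - int N + 1 + int (s i) < 0"
          using that by (auto simp: a_def staircase_def of_nat_diff)
        then have "A $$ (i, s i) = 0"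
          using that sN[of i] by (simp add: A_def complete_homogeneous_eq)
        then show False using 2 that by simp
      qed
      have "s (r - 1) < r - 1"
      proof (rule ccontr)
        assume "\<not> ?thesis"
        then have "i \<le> s i" if "i < N" for i using ge[OF that] by (cases "i = r - 1") auto
        then have "s = id" using s(1) by (intro permutes_natset_ge) auto
        then show False using s(2) by simp
      qed
      then have "hom_poly N (k + (s (r - 1) + 1)) \<in> I"
        using less by (intro less.IH) auto
      moreover have "A $$ (r - 1, s (r - 1)) = hom_poly N (k + (s (r - 1) + 1))"
        using less.prems sN[of "r - 1"]
        by (auto simp: A_def a_def complete_homogeneous_eq intro!: arg_cong[of _ _ "hom_poly N"])
      ultimately have "A $$ (r - 1, s (r - 1)) \<in> I" by simp
      then have "(\<Prod>i\<in>{0..<N} - {r - 1}. A $$ (i, s i)) * A $$ (r - 1, s (r - 1)) \<in> I"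
        by (intro ideal_mult symmetric_polys_prod Asym) (auto simp: sN)
      then have "(\<Prod>i = 0..<N. A $$ (i, s i)) \<in> I"
        using less.prems by (subst prod.remove[of _ "r - 1"]) (auto simp: mult.commute)
      then show ?thesis unfolding trm_def by (intro ideal_mult symmetric_polys_signof)
    qed
  qed
  have "jacobi_trudi N a = sum trm {s. s permutes {0..<N}}"
    unfolding jacobi_trudi_def A_def[symmetric] trm_def by (rule det_def') (simp add: A_def)
  also have "\<dots> = trm id + sum trm ({s. s permutes {0..<N}} - {id})"
    by (rule sum.remove) (auto simp: finite_permutations permutes_id)
  finally have "jacobi_trudi N a = trm id + sum trm ({s. s permutes {0..<N}} - {id})" .
  moreover have "sum trm ({s. s permutes {0..<N}} - {id}) \<in> I"
    by (rule ideal_sum) (use others in auto)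
  moreover have "jacobi_trudi N a \<in> I" using hook_ideal[OF less.prems] unfolding a_def by simp
  ultimately have "trm id \<in> I"
    using ideal_diff[of "jacobi_trudi N a" "sum trm ({s. s permutes {0..<N}} - {id})"] by simp
  moreover have "trm id = hom_poly N (k + r)"
  proof -
    have "(\<Prod>i = 0..<N. A $$ (i, i)) = (\<Prod>i = 0..<N. if i = r - 1 then hom_poly N (k + r) else 1)"
      using less.prems
      by (intro prod.cong) (auto simp: A_def a_def staircase_def complete_homogeneous_eq of_nat_diff
          hom_poly_0 intro!: arg_cong[of _ _ "hom_poly N"])
    then show ?thesis using less.prems by (simp add: trm_def)
  qed
  ultimately show ?case by simp
qed

lemma complete_homogeneous_recurrence:
  assumes "0 < m"
  shows "h m = - (\<Sum>i=1..N. fps_nth (elem_series {..<N}) i * h (m - int i))"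
proof -
  let ?p = "fps_nth (elem_series {..<N})"
  obtain l where l: "m = int (Suc l)" using assms by (metis gr0_implies_Suc zero_less_imp_eq_int)
  have "(\<Sum>i=0..N. ?p i * h (m - int i)) = (\<Sum>i\<le>Suc l + N. ?p i * h (m - int i))"
    by (rule sum.mono_neutral_left) (auto simp: elem_series_nth_gt)
  also have "\<dots> = (\<Sum>i\<le>Suc l. ?p i * h (m - int i))"
    by (rule sum.mono_neutral_right) (auto simp: l complete_homogeneous_eq)
  also have "\<dots> = (\<Sum>i\<le>Suc l. ?p i * hom_poly N (Suc l - i))"
    by (intro sum.cong refl) (auto simp: l complete_homogeneous_eq nat_diff_distrib simp del: of_nat_Suc)
  also have "\<dots> = 0" by (rule elem_series_recurrence)
  finally have "h m + (\<Sum>i=1..N. ?p i * h (m - int i)) = 0"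
    by (simp add: sum.atLeast_Suc_atMost elem_series_nth_0)
  then show ?thesis by (simp add: eq_neg_iff_add_eq_0)
qed

text \<open>The class of \<open>h\<^sub>k\<close> is the simple current; the sign is that of the cyclic permutation of \<open>N\<close> rows.\<close>

definition rot_factor :: mpolynomial where
  "rot_factor = (-1) ^ (N - 1) * hom_poly N k"

lemma symmetric_rot_factor: "rot_factor \<in> symmetric_polys N"
  unfolding rot_factor_def
  by (intro symmetric_polys_mult symmetric_polys_power symmetric_polys_uminus symmetric_polys_1
      symmetric_polys_hom_poly)

text \<open>Both sides satisfy the same recurrence of order \<open>N\<close>. They agree at the first \<open>N\<close> arguments: for
  \<open>l < N - 1\<close> the left side is in the ideal and the right side is zero, and for \<open>l = N - 1\<close> the recurrence
  leaves only its last term \<open>(-1)\<^sup>N e\<^sub>N h\<^sub>k\<close>, where \<open>e\<^sub>N = 1\<close> in the fusion algebra.\<close>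

lemma complete_homogeneous_periodic:
  "h (int k + 1 + int l) \<approx> rot_factor * h (int l - int N + 1)"
proof (induction l rule: less_induct)
  case (less l)
  let ?p = "fps_nth (elem_series {..<N})"
  have rec: "h (int k + 1 + int l) = - (\<Sum>i=1..N. ?p i * h (int k + 1 + int l - int i))"
    by (rule complete_homogeneous_recurrence) simp
  consider "l < N - 1" | "l = N - 1" | "N \<le> l" by linarith
  then show ?case
  proof cases
    case 1
    then have "h (int k + 1 + int l) = hom_poly N (k + (l + 1))" "h (int l - int N + 1) = 0"
      by (auto simp: complete_homogeneous_eq intro!: arg_cong[of _ _ "hom_poly N"])
    then show ?thesis using hom_poly_ideal[of "l + 1"] 1 by (simp add: fcong_0)
  next
    case 2
    have "(\<Sum>i=1..N. ?p i * h (int k + 1 + int l - int i)) \<approx>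
        (\<Sum>i=1..N. if i = N then (-1) ^ N * hom_poly N k else 0)"
    proof (rule fcong_sum)
      fix i assume i: "i \<in> {1..N}"
      show "?p i * h (int k + 1 + int l - int i) \<approx> (if i = N then (-1) ^ N * hom_poly N k else 0)"
      proof (cases "i = N")
        case True
        have "?p N = (-1) ^ N * schur N (replicate N 1)"
          using elem_series_nth_card[of "{..<N}"] schur_column[OF two_le_N] by simp
        moreover have "h (int k + 1 + int l - int N) = hom_poly N k"
          using 2 two_le_N by (simp add: complete_homogeneous_eq of_nat_diff)
        moreover have "((-1) ^ N * hom_poly N k) * schur N (replicate N 1) \<approx> ((-1) ^ N * hom_poly N k) * 1"
          using generators_in_ideal(1)
          by (intro fcong_mult_left symmetric_polys_mult symmetric_polys_power symmetric_polys_uminus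
              symmetric_polys_1 symmetric_polys_hom_poly) (simp add: fcong_def)
        ultimately show ?thesis using True by (simp add: ac_simps)
      next
        case False
        have "h (int k + 1 + int l - int i) = hom_poly N (k + (N - i))"
          using 2 i two_le_N
          by (auto simp: complete_homogeneous_eq intro!: arg_cong[of _ _ "hom_poly N"])
        then have "h (int k + 1 + int l - int i) \<in> I"
          using hom_poly_ideal[of "N - i"] i False by auto
        then show ?thesis
          using False ideal_mult[OF symmetric_polys_elem_series] by (simp add: fcong_0)
      qed
    qed
    then have "h (int k + 1 + int l) \<approx> - ((-1) ^ N * hom_poly N k)"
      unfolding rec using two_le_N by (intro fcong_uminus) simp
    moreover have "(-1) ^ N = - ((-1) ^ (N - 1) :: mpolynomial)"
      using two_le_N by (cases N) simp_all
    then have "- ((-1) ^ N * hom_poly N k) = rot_factor"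
      unfolding rot_factor_def by (simp only: minus_mult_left minus_minus)
    moreover have "h (int l - int N + 1) = 1"
      using 2 two_le_N by (simp add: complete_homogeneous_eq hom_poly_0 of_nat_diff)
    ultimately show ?thesis by simp
  next
    case 3
    have "(\<Sum>i=1..N. ?p i * h (int k + 1 + int l - int i)) \<approx>
        (\<Sum>i=1..N. ?p i * (rot_factor * h (int l - int N + 1 - int i)))"
    proof (intro fcong_sum fcong_mult_left symmetric_polys_elem_series)
      fix i assume i: "i \<in> {1..N}"
      have "l - i < l" using 3 i two_le_N by auto
      moreover have "int (l - i) = int l - int i" using 3 i by (simp add: of_nat_diff)
      ultimately show "h (int k + 1 + int l - int i) \<approx> rot_factor * h (int l - int N + 1 - int i)"
        using less.IH[of "l - i"] by (simp add: algebra_simps)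
    qed
    then have "h (int k + 1 + int l) \<approx> - (\<Sum>i=1..N. ?p i * (rot_factor * h (int l - int N + 1 - int i)))"
      unfolding rec by (rule fcong_uminus)
    also have "\<dots> = rot_factor * - (\<Sum>i=1..N. ?p i * h (int l - int N + 1 - int i))"
      by (simp add: sum_distrib_left ac_simps)
    also have "- (\<Sum>i=1..N. ?p i * h (int l - int N + 1 - int i)) = h (int l - int N + 1)"
      by (rule complete_homogeneous_recurrence[symmetric]) (use 3 in auto)
    finally show ?thesis .
  qed
qed

lemma jacobi_trudi_row_shift:
  assumes "i < N"
  shows "jacobi_trudi N (a(i := a i + n)) \<approx> rot_factor * jacobi_trudi N a"
proof -
  define e where "e i' j = h (int (a i') - int N + 1 + int j)" for i' j :: nat
  define f where "f = (\<lambda>(i', j). if i' = i then h (int k + 1 + int (a i + j)) else e i' j)"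
  define g where "g = (\<lambda>(i', j). if i' = i then rot_factor * e i' j else e i' j)"
  have esym: "e i' j \<in> symmetric_polys N" for i' j
    by (simp add: e_def symmetric_polys_complete_homogeneous)
  have "jacobi_trudi N (a(i := a i + n)) = det (mat N N f)"
    unfolding jacobi_trudi_def f_def e_def
    by (intro arg_cong[of _ _ det] cong_mat) (auto intro!: arg_cong[of _ _ "complete_homogeneous N"])
  also have "det (mat N N f) \<approx> det (mat N N g)"
  proof (rule fcong_det)
    fix i' j
    have "h (int k + 1 + int (a i + j)) \<approx> rot_factor * h (int (a i + j) - int N + 1)"
      by (rule complete_homogeneous_periodic)
    moreover have "h (int (a i + j) - int N + 1) = e i j"
      unfolding e_def by (rule arg_cong[of _ _ "complete_homogeneous N"]) simp
    ultimately show "f (i', j) \<approx> g (i', j)" by (simp add: f_def g_def fcong_refl)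
    show "f (i', j) \<in> symmetric_polys N"
      by (simp add: f_def esym symmetric_polys_complete_homogeneous)
    show "g (i', j) \<in> symmetric_polys N"
      by (simp add: g_def esym symmetric_polys_mult symmetric_rot_factor)
  qed
  also have "mat N N g = multrow i rot_factor (mat N N (\<lambda>(i', j). e i' j))"
    by (rule eq_matI) (auto simp: g_def)
  also have "det (multrow i rot_factor (mat N N (\<lambda>(i', j). e i' j))) = rot_factor * jacobi_trudi N a"
    unfolding jacobi_trudi_def e_def by (rule det_multrow[OF assms]) simp
  finally show ?thesis .
qed

text \<open>Raising row \<open>i\<close> or row \<open>j\<close> by \<open>n\<close> gives the same factor, so \<open>n\<close> can be carried from one row to the other;
  this turns an ordinary exchange of rows into the affine reflection.\<close>

lemma jacobi_trudi_affine_swap: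
  assumes "i < N" "j < N" "i \<noteq> j" "n \<le> b i"
  shows "jacobi_trudi N (b(i := b j + n, j := b i - n)) \<approx> - jacobi_trudi N b"
proof -
  define a where "a = b(i := b i - n)"
  have 1: "b = a(i := a i + n)" using assms by (auto simp: a_def)
  have 2: "b(i := b j + n, j := b i - n) = (a \<circ> transpose i j)(i := (a \<circ> transpose i j) i + n)"
    using assms by (auto simp: a_def fun_eq_iff transpose_def)
  have "jacobi_trudi N (b(i := b j + n, j := b i - n)) \<approx> rot_factor * jacobi_trudi N (a \<circ> transpose i j)"
    unfolding 2 by (rule jacobi_trudi_row_shift[OF assms(1)])
  also have "rot_factor * jacobi_trudi N (a \<circ> transpose i j) = - (rot_factor * jacobi_trudi N a)"
    using jacobi_trudi_swap[OF assms(1-3)] by simp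
  also have "- (rot_factor * jacobi_trudi N a) \<approx> - jacobi_trudi N b"
    using jacobi_trudi_row_shift[OF assms(1), of a] 1 by (metis fcong_sym fcong_uminus)
  finally show ?thesis .
qed

end

section \<open>The fusion Pieri rule\<close>

lemma sum_lessThan_two_changed:
  fixes d d' :: "nat \<Rightarrow> nat"
  assumes "u < N" "v < N" "u \<noteq> v" "d' u + d' v = d u + d v"
    and "\<And>j. j \<noteq> u \<Longrightarrow> j \<noteq> v \<Longrightarrow> d' j = d j"
  shows "(\<Sum>i<N. d' i) = (\<Sum>i<N. d i)"
proof -
  have s: "(\<Sum>i<N. f i) = f u + f v + (\<Sum>i\<in>{..<N} - {u, v}. f i)" for f :: "nat \<Rightarrow> nat"
  proof -
    have "(\<Sum>i<N. f i) = (\<Sum>i\<in>{u, v}. f i) + (\<Sum>i\<in>{..<N} - {u, v}. f i)"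
      using assms by (subst sum.subset_diff[of "{u, v}"]) auto
    then show ?thesis using assms(3) by simp
  qed
  have "(\<Sum>i\<in>{..<N} - {u, v}. d' i) = (\<Sum>i\<in>{..<N} - {u, v}. d i)"
    using assms(5) by (intro sum.cong) auto
  then show ?thesis using assms(4) by (simp add: s)
qed

text \<open>The shifted parts of the partition whose weight has content \<open>b\<close>; the entry \<open>b 0\<close> is recovered from the
  level in \<open>exponents_first\<close>.\<close>

definition exponents :: "nat \<Rightarrow> (nat \<Rightarrow> nat) \<Rightarrow> nat \<Rightarrow> nat" where
  "exponents N b i = (\<Sum>j\<in>{i<..<N}. b j + 1)"

text \<open>The content after \<open>d i\<close> of the \<open>b i\<close> entries \<open>i\<close> have been increased by one modulo \<open>N\<close>.\<close>

definition move_along :: "nat \<Rightarrow> (nat \<Rightarrow> nat) \<Rightarrow> (nat \<Rightarrow> nat) \<Rightarrow> nat \<Rightarrow> nat" where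
  "move_along N b d i = (if i < N then b i - d i + d (if i = 0 then N - 1 else i - 1) else 0)"

definition rotate_content :: "nat \<Rightarrow> (nat \<Rightarrow> nat) \<Rightarrow> nat \<Rightarrow> nat" where
  "rotate_content N b i = (if i < N then b (if i = 0 then N - 1 else i - 1) else 0)"

definition sub_contents :: "nat \<Rightarrow> (nat \<Rightarrow> nat) \<Rightarrow> nat \<Rightarrow> (nat \<Rightarrow> nat) set" where
  "sub_contents N b m = {d \<in> compositions N m. \<forall>i<N. d i \<le> b i}"

lemma exponents_step:
  assumes "0 < i" "i < N"
  shows "exponents N b (i - 1) = exponents N b i + b i + 1"
proof -
  have "{i - 1<..<N} = insert i {i<..<N}" using assms by auto
  then show ?thesis by (simp add: exponents_def)
qed

lemma exponents_last: "exponents N b (N - 1) = 0"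
proof -
  have "{N - 1<..<N} = {}" by auto
  then show ?thesis by (simp only: exponents_def sum.empty)
qed

lemma exponents_first:
  assumes "0 < N" "b \<in> compositions N k"
  shows "N + k = exponents N b 0 + b 0 + 1"
proof -
  have "{..<N} = insert 0 {0<..<N}" using assms by auto
  then have "k = b 0 + (\<Sum>j\<in>{0<..<N}. b j)" using assms by (simp add: compositions_def)
  moreover have "exponents N b 0 = (\<Sum>j\<in>{0<..<N}. b j) + (N - 1)"
    by (simp only: exponents_def sum.distrib) simp
  ultimately show ?thesis using assms(1) by simp
qed

lemma exponents_strict: "i < j \<Longrightarrow> j < N \<Longrightarrow> exponents N b j < exponents N b i"
  unfolding exponents_def by (rule sum_strict_mono2[of _ _ j]) auto

lemma alcove_exponents:
  "0 < N \<Longrightarrow> b \<in> compositions N k \<Longrightarrow> alcove N (N + k) (exponents N b)"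
  using exponents_first[of N b k] exponents_strict[of _ _ N b] exponents_last[of N b]
  by (auto simp: alcove_def)

lemma exponents_inj:
  assumes "0 < N" "b \<in> compositions N k" "c \<in> compositions N k"
    and "\<forall>i<N. exponents N b i = exponents N c i"
  shows "b = c"
proof
  fix i
  consider "i = 0" | "0 < i" "i < N" | "N \<le> i" by linarith
  then show "b i = c i"
  proof cases
    case 1
    then show ?thesis using assms exponents_first[of N b k] exponents_first[of N c k] by auto
  next
    case 2
    then show ?thesis using assms(4) exponents_step[of i N b] exponents_step[of i N c]
      by (metis add_left_cancel add_right_cancel diff_le_self le_less_trans)
  next
    case 3
    then show ?thesis using assms by (simp add: compositions_def)
  qed
qed

text \<open>Adding \<open>d i\<close> boxes to row \<open>i\<close> of the partition moves \<open>d i\<close> units of content from \<open>i\<close> to \<open>i + 1\<close>, up to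
  columns of length \<open>N\<close>, of which there are \<open>d (N - 1)\<close>.\<close>

lemma exponents_move_along:
  assumes "\<forall>i<N. d i \<le> b i" "i < N"
  shows "exponents N (move_along N b d) i + d (N - 1) = exponents N b i + d i"
proof -
  have "i \<le> N - 1" using assms by simp
  then show ?thesis
  proof (induction i rule: inc_induct)
    case base
    then show ?case by (simp only: exponents_last)
  next
    case (step i)
    have "exponents N c i = exponents N c (Suc i) + c (Suc i) + 1" for c
      using exponents_step[of "Suc i" N c] step.hyps by simp
    moreover have "d (Suc i) \<le> b (Suc i)" using assms step.hyps by simp
    moreover have "move_along N b d (Suc i) = b (Suc i) - d (Suc i) + d i"
      using step.hyps by (simp add: move_along_def)
    ultimately show ?case using step.IH by simp
  qed
qed

lemma sum_cyclic_predecessor: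
  fixes f :: "nat \<Rightarrow> nat"
  shows "(\<Sum>i<N. f (if i = 0 then N - 1 else i - 1)) = (\<Sum>i<N. f i)"
proof (cases N)
  case (Suc M)
  have "(\<Sum>i<Suc M. f (if i = 0 then N - 1 else i - 1)) = f M + (\<Sum>i<M. f i)"
    using Suc by (simp add: sum.lessThan_Suc_shift del: sum.lessThan_Suc)
  then show ?thesis using Suc by simp
qed simp

lemma move_along_compositions:
  assumes "b \<in> compositions N k" "\<forall>i<N. d i \<le> b i"
  shows "move_along N b d \<in> compositions N k"
proof -
  have "(\<Sum>i<N. move_along N b d i) = (\<Sum>i<N. (b i - d i) + d (if i = 0 then N - 1 else i - 1))"
    by (intro sum.cong) (auto simp: move_along_def)
  also have "\<dots> = (\<Sum>i<N. b i - d i) + (\<Sum>i<N. d i)"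
    by (simp only: sum.distrib sum_cyclic_predecessor)
  also have "\<dots> = (\<Sum>i<N. b i)" unfolding sum.distrib[symmetric] using assms(2) by (intro sum.cong) auto
  finally show ?thesis using assms(1) by (simp add: compositions_def move_along_def)
qed

lemma rotate_content_compositions:
  "b \<in> compositions N k \<Longrightarrow> rotate_content N b \<in> compositions N k"
  using sum_cyclic_predecessor[of b N] by (auto simp: compositions_def rotate_content_def)

lemma rotate_content_funpow_compositions:
  "b \<in> compositions N k \<Longrightarrow> (rotate_content N ^^ t) b \<in> compositions N k"
  by (induction t) (auto intro: rotate_content_compositions)

lemma finite_sub_contents: "finite (sub_contents N b m)"
  unfolding sub_contents_def by (simp add: finite_compositions)

lemma sub_contents_full:
  assumes "b \<in> compositions N k"
  shows "sub_contents N b k = {b}"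
proof -
  have "d = b" if d: "d \<in> sub_contents N b k" for d
  proof -
    have "d i = b i" if "i < N" for i
    proof (rule ccontr)
      assume "d i \<noteq> b i"
      then have "(\<Sum>i<N. d i) < (\<Sum>i<N. b i)"
        using d that by (intro sum_strict_mono_ex1) (auto simp: sub_contents_def intro!: bexI[of _ i])
      then show False using d assms by (simp add: sub_contents_def compositions_def)
    qed
    then show ?thesis using d assms
      by (auto simp: fun_eq_iff sub_contents_def compositions_def) (metis not_le)
  qed
  then show ?thesis using assms by (auto simp: sub_contents_def)
qed

lemma move_along_full: "move_along N b b = rotate_content N b"
  by (auto simp: move_along_def rotate_content_def)

context fusion_level
begin

text \<open>Fixed points of \<open>f\<close> cause no trouble: twice the sum is in the ideal, and the coefficients are rational.\<close>

lemma involution_sum_ideal: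
  assumes "\<And>x. x \<in> A \<Longrightarrow> f x \<in> A" "\<And>x. x \<in> A \<Longrightarrow> f (f x) = x" "\<And>x. x \<in> A \<Longrightarrow> F (f x) \<approx> - F x"
  shows "sum F A \<in> I"
proof (rule ideal_half)
  have "sum F A = (\<Sum>x\<in>A. F (f x))"
    by (rule sum.reindex_bij_witness[of A f f]) (use assms in auto)
  then have "sum F A + sum F A = (\<Sum>x\<in>A. F (f x) - - F x)" by (simp add: sum.distrib)
  also have "\<dots> \<in> I" by (rule ideal_sum) (use assms(3) in \<open>simp add: fcong_def\<close>)
  finally show "sum F A + sum F A \<in> I" .
qed

text \<open>The rows \<open>d\<close> added to the partition form a horizontal strip.\<close>

definition interlacing :: "(nat \<Rightarrow> nat) \<Rightarrow> (nat \<Rightarrow> nat) \<Rightarrow> bool" where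
  "interlacing a d \<longleftrightarrow> (\<forall>i. 0 < i \<longrightarrow> i < N \<longrightarrow> a i + d i < a (i - 1))"

text \<open>The involution of the classical Pieri rule: exchange the exponents in rows \<open>i - 1\<close> and \<open>i\<close> for the
  largest row \<open>i\<close> at which \<open>d\<close> fails to interlace. Rows below \<open>i\<close> are not affected, and row \<open>i\<close> keeps
  failing, so the same \<open>i\<close> is found again.\<close>

lemma not_interlacing_sum_ideal:
  assumes a: "alcove N n a"
  shows "(\<Sum>d | d \<in> compositions N m \<and> \<not> interlacing a d. jacobi_trudi N (\<lambda>i. a i + d i)) \<in> I"
proof -
  define V where "V d = {i. 0 < i \<and> i < N \<and> a (i - 1) \<le> a i + d i}" for d
  define f where "f d = (let i = Max (V d) in
      d(i - 1 := a i + d i - a (i - 1), i := a (i - 1) + d (i - 1) - a i))" for d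
  have finV: "finite (V d)" for d by (rule finite_subset[of _ "{..<N}"]) (auto simp: V_def)
  have V: "interlacing a d \<longleftrightarrow> V d = {}" for d
    by (auto simp: interlacing_def V_def not_le)
  have *: "f d \<in> compositions N m \<and> \<not> interlacing a (f d) \<and> f (f d) = d \<and>
      jacobi_trudi N (\<lambda>i. a i + f d i) = - jacobi_trudi N (\<lambda>i. a i + d i)"
    if d: "d \<in> compositions N m" "\<not> interlacing a d" for d
  proof -
    define i where "i = Max (V d)"
    have iV: "i \<in> V d" unfolding i_def using d(2) finV V by (intro Max_in) auto
    then have i: "0 < i" "i < N" "a (i - 1) \<le> a i + d i" by (auto simp: V_def)
    have dec: "a i < a (i - 1)" using a i by (simp add: alcove_def)
    have fd: "f d = d(i - 1 := a i + d i - a (i - 1), i := a (i - 1) + d (i - 1) - a i)"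
      by (simp add: f_def i_def Let_def)
    have "j \<le> i" if "j \<in> V (f d)" for j
    proof (rule ccontr)
      assume "\<not> j \<le> i"
      then have "j \<in> V d" using that by (auto simp: V_def fd split: if_splits)
      then show False using \<open>\<not> j \<le> i\<close> finV i_def by simp
    qed
    moreover have iV': "i \<in> V (f d)" using i dec by (simp add: V_def fd)
    ultimately have max: "Max (V (f d)) = i" using finV by (intro Max_eqI) auto
    have "f (f d) = (f d)(i - 1 := a i + f d i - a (i - 1), i := a (i - 1) + f d (i - 1) - a i)"
      using max by (simp add: f_def[of "f d"])
    also have "\<dots> = d" using i dec by (auto simp: fd fun_eq_iff)
    finally have inv: "f (f d) = d" .
    have "(\<Sum>j<N. f d j) = (\<Sum>j<N. d j)"
      by (rule sum_lessThan_two_changed[of "i - 1" _ i]) (use i dec in \<open>auto simp: fd\<close>)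
    then have comp: "f d \<in> compositions N m" using d i by (auto simp: compositions_def fd)
    have "(\<lambda>j. a j + f d j) = (\<lambda>j. a j + d j) \<circ> transpose (i - 1) i"
      using i dec by (auto simp: fd fun_eq_iff transpose_def)
    then have "jacobi_trudi N (\<lambda>j. a j + f d j) = - jacobi_trudi N (\<lambda>j. a j + d j)"
      using jacobi_trudi_swap[of "i - 1" N i "\<lambda>j. a j + d j"] i by simp
    then show ?thesis using inv comp iV' V by auto
  qed
  show ?thesis
    by (rule involution_sum_ideal[where f = f]) (use * in \<open>auto intro: fcong_eq\<close>)
qed

text \<open>The affine counterpart of the previous lemma for strips whose first row is too long. Let
  \<open>x = a 0 + d 0 - n\<close>, which is less than \<open>a 0\<close> because \<open>d 0 \<le> k < n\<close>. There is a unique row \<open>j > 0\<close> with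
  \<open>a j \<le> x < a (j - 1)\<close>; the interlacing exponent \<open>a j + d j\<close> lies in the same interval, so the affine exchange of
  the rows \<open>0\<close> and \<open>j\<close> again gives an overflowing horizontal strip with the same \<open>j\<close>.\<close>

lemma overflowing_sum_ideal:
  assumes a: "alcove N n a" and m: "m \<le> k"
  shows "(\<Sum>d | d \<in> compositions N m \<and> interlacing a d \<and> n \<le> a 0 + d 0.
            jacobi_trudi N (\<lambda>i. a i + d i)) \<in> I"
proof -
  define r where "r d = (LEAST j. a j \<le> a 0 + d 0 - n)" for d :: "nat \<Rightarrow> nat"
  define f where "f d = (let j = r d in d(0 := a j + d j + n - a 0, j := a 0 + d 0 - n - a j))" for d
  have *: "f d \<in> compositions N m \<and> interlacing a (f d) \<and> n \<le> a 0 + f d 0 \<and> f (f d) = d \<and>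
      jacobi_trudi N (\<lambda>i. a i + f d i) \<approx> - jacobi_trudi N (\<lambda>i. a i + d i)"
    if d: "d \<in> compositions N m" "interlacing a d" "n \<le> a 0 + d 0" for d
  proof -
    define x where "x = a 0 + d 0 - n"
    define j where "j = r d"
    have last: "a (N - 1) \<le> x" using a by (simp add: alcove_def)
    have jx: "a j \<le> x" unfolding j_def r_def x_def[symmetric] by (rule LeastI[of _ "N - 1"]) (rule last)
    have jmin: "j \<le> i" if "a i \<le> x" for i
      unfolding j_def r_def x_def[symmetric] using that by (rule Least_le)
    have "j \<le> N - 1" by (rule jmin[OF last])
    then have jN: "j < N" using two_le_N by simp
    have "d 0 \<le> (\<Sum>i<N. d i)" using two_le_N by (intro member_le_sum) auto
    then have "d 0 < n" using d(1) m two_le_N by (simp add: compositions_def)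
    have a0: "a 0 < n" using a by (simp add: alcove_def)
    have "x < a 0" using \<open>d 0 < n\<close> d(3) by (simp add: x_def)
    then have j0: "0 < j" using jx by (cases "j = 0") auto
    have jpred: "x < a (j - 1)" using jmin[of "j - 1"] j0 by (cases "a (j - 1) \<le> x") auto
    have dj: "a j + d j < a (j - 1)" using d(2) j0 jN by (simp add: interlacing_def)
    have fd: "f d = d(0 := a j + d j + n - a 0, j := x - a j)"
      by (simp add: f_def j_def Let_def x_def)
    have fd0: "a 0 + f d 0 = a j + d j + n" using j0 a0 by (simp add: fd)
    have fdj: "a j + f d j = x" using jx by (simp add: fd)
    have "interlacing a (f d)"
      using d(2) jpred fdj unfolding interlacing_def by (auto simp: fd)
    have "r (f d) = j"
      unfolding r_def
    proof (rule Least_equality)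
      show "a j \<le> a 0 + f d 0 - n" using fd0 by simp
      fix i assume "a i \<le> a 0 + f d 0 - n"
      then have i: "a i < a (j - 1)" using fd0 dj by simp
      show "j \<le> i"
      proof (rule ccontr)
        assume "\<not> j \<le> i"
        then have "i = j - 1 \<or> i < j - 1" by auto
        moreover have "a (j - 1) < a i" if "i < j - 1" using a jN that by (simp add: alcove_def)
        ultimately have "a (j - 1) \<le> a i" by auto
        then show False using i by simp
      qed
    qed
    then have "f (f d) = (f d)(0 := a j + f d j + n - a 0, j := a 0 + f d 0 - n - a j)"
      by (simp add: f_def[of "f d"])
    also have "\<dots> = d" unfolding fdj fd0 using d(3) j0 by (auto simp: fd x_def fun_eq_iff)
    finally have inv: "f (f d) = d" .
    have "f d 0 + f d j = d 0 + d j" using fd0 fdj d(3) by (simp add: x_def)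
    then have "(\<Sum>j<N. f d j) = (\<Sum>j<N. d j)"
      by (intro sum_lessThan_two_changed[of 0 _ j]) (use j0 jN in \<open>auto simp: fd\<close>)
    then have comp: "f d \<in> compositions N m" using d jN two_le_N by (auto simp: compositions_def fd)
    have "(\<lambda>i. a i + f d i) = (\<lambda>i. a i + d i)(0 := (a j + d j) + n, j := (a 0 + d 0) - n)"
      using fd0 fdj j0 by (auto simp: fd x_def fun_eq_iff)
    moreover have "jacobi_trudi N ((\<lambda>i. a i + d i)(0 := (a j + d j) + n, j := (a 0 + d 0) - n))
        \<approx> - jacobi_trudi N (\<lambda>i. a i + d i)"
      using jacobi_trudi_affine_swap[of 0 j "\<lambda>i. a i + d i"] jN j0 d(3) by simp
    ultimately show ?thesis using inv comp fd0 \<open>interlacing a (f d)\<close> by simp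
  qed
  show ?thesis
    by (rule involution_sum_ideal[where f = f]) (use * in auto)
qed

lemma fusion_pieri_alcove:
  assumes a: "alcove N n a" and m: "m \<le> k"
  shows "hom_poly N m * jacobi_trudi N a \<approx>
    (\<Sum>d | d \<in> compositions N m \<and> interlacing a d \<and> a 0 + d 0 < n. jacobi_trudi N (\<lambda>i. a i + d i))"
proof -
  let ?F = "\<lambda>d. jacobi_trudi N (\<lambda>i. a i + d i)"
  let ?A = "{d. d \<in> compositions N m \<and> \<not> interlacing a d}"
  let ?B = "{d. d \<in> compositions N m \<and> interlacing a d \<and> n \<le> a 0 + d 0}"
  let ?C = "{d. d \<in> compositions N m \<and> interlacing a d \<and> a 0 + d 0 < n}"
  have fin: "finite ?A" "finite ?B" "finite ?C" by (simp_all add: finite_compositions)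
  have "compositions N m = ?A \<union> (?B \<union> ?C)" by auto
  then have "sum ?F (compositions N m) = sum ?F (?A \<union> (?B \<union> ?C))" by simp
  also have "\<dots> = sum ?F ?A + sum ?F (?B \<union> ?C)" by (rule sum.union_disjoint) (use fin in auto)
  also have "sum ?F (?B \<union> ?C) = sum ?F ?B + sum ?F ?C" by (rule sum.union_disjoint) (use fin in auto)
  finally have "sum ?F (compositions N m) - sum ?F ?C = sum ?F ?A + sum ?F ?B" by simp
  also have "\<dots> \<in> I"
    by (intro ideal_add not_interlacing_sum_ideal overflowing_sum_ideal assms)
  finally show ?thesis by (simp add: fcong_def pieri_hom_poly[OF two_le_N])
qed

definition schur_content :: "(nat \<Rightarrow> nat) \<Rightarrow> mpolynomial" where
  "schur_content b = jacobi_trudi N (exponents N b)"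

lemma symmetric_schur_content: "schur_content b \<in> symmetric_polys N"
  by (simp add: schur_content_def symmetric_polys_jacobi_trudi)

lemma jacobi_trudi_shift_fcong: "jacobi_trudi N (\<lambda>i. a i + c) \<approx> jacobi_trudi N a"
proof (induction c)
  case (Suc c)
  have "jacobi_trudi N (\<lambda>i. a i + Suc c) = schur N (replicate N 1) * jacobi_trudi N (\<lambda>i. a i + c)"
    using jacobi_trudi_shift[OF two_le_N, of "\<lambda>i. a i + c"] by simp
  also have "\<dots> = jacobi_trudi N (\<lambda>i. a i + c) * schur N (replicate N 1)" by (rule mult.commute)
  also have "\<dots> \<approx> jacobi_trudi N (\<lambda>i. a i + c) * 1"
    using generators_in_ideal(1)
    by (intro fcong_mult_left symmetric_polys_jacobi_trudi) (simp add: fcong_def)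
  finally show ?case using Suc fcong_trans by simp
qed (simp add: fcong_refl)

lemma jacobi_trudi_move_along:
  assumes "\<forall>i<N. d i \<le> b i"
  shows "jacobi_trudi N (\<lambda>i. exponents N b i + d i) \<approx> schur_content (move_along N b d)"
proof -
  have "jacobi_trudi N (\<lambda>i. exponents N b i + d i) =
      jacobi_trudi N (\<lambda>i. exponents N (move_along N b d) i + d (N - 1))"
    using exponents_move_along[OF assms] by (intro jacobi_trudi_cong) auto
  also have "\<dots> \<approx> schur_content (move_along N b d)"
    unfolding schur_content_def by (rule jacobi_trudi_shift_fcong)
  finally show ?thesis .
qed

text \<open>In terms of contents the conditions on horizontal strips and on the length of the first row become
  the single symmetric condition \<open>d i \<le> b i\<close>, where \<open>i = 0\<close> is the affine one.\<close>

theorem fusion_pieri: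
  assumes b: "b \<in> compositions N k" and m: "m \<le> k"
  shows "hom_poly N m * schur_content b \<approx>
    (\<Sum>d\<in>sub_contents N b m. schur_content (move_along N b d))"
proof -
  have N0: "0 < N" using two_le_N by simp
  have "d \<in> compositions N m \<and> interlacing (exponents N b) d \<and> exponents N b 0 + d 0 < n \<longleftrightarrow>
      d \<in> sub_contents N b m" for d
  proof -
    have "interlacing (exponents N b) d \<longleftrightarrow> (\<forall>i. 0 < i \<longrightarrow> i < N \<longrightarrow> d i \<le> b i)"
    proof -
      have "exponents N b i + d i < exponents N b (i - 1) \<longleftrightarrow> d i \<le> b i" if "0 < i" "i < N" for i
        using exponents_step[OF that, of b] by auto
      then show ?thesis unfolding interlacing_def by blast
    qed
    moreover have "exponents N b 0 + d 0 < n \<longleftrightarrow> d 0 \<le> b 0"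
      using exponents_first[OF N0 b] by auto
    ultimately show ?thesis
      using N0 by (auto simp: sub_contents_def) (metis gr0I)
  qed
  then have "hom_poly N m * schur_content b \<approx>
      (\<Sum>d\<in>sub_contents N b m. jacobi_trudi N (\<lambda>i. exponents N b i + d i))"
    using fusion_pieri_alcove[OF alcove_exponents[OF N0 b] m] by (simp add: schur_content_def)
  also have "\<dots> \<approx> (\<Sum>d\<in>sub_contents N b m. schur_content (move_along N b d))"
    by (intro fcong_sum jacobi_trudi_move_along) (simp add: sub_contents_def)
  finally show ?thesis .
qed

corollary simple_current_rotates:
  assumes "b \<in> compositions N k"
  shows "hom_poly N k * schur_content b \<approx> schur_content (rotate_content N b)"
  using fusion_pieri[OF assms order.refl] by (simp add: sub_contents_full[OF assms] move_along_full)

lemma simple_current_power_rotates: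
  assumes "b \<in> compositions N k"
  shows "hom_poly N k ^ t * schur_content b \<approx> schur_content ((rotate_content N ^^ t) b)"
proof (induction t)
  case (Suc t)
  have "hom_poly N k ^ Suc t * schur_content b = hom_poly N k * (hom_poly N k ^ t * schur_content b)"
    by (simp add: mult.assoc)
  also have "\<dots> \<approx> hom_poly N k * schur_content ((rotate_content N ^^ t) b)"
    by (rule fcong_mult_left[OF symmetric_polys_hom_poly Suc])
  also have "\<dots> \<approx> schur_content ((rotate_content N ^^ Suc t) b)"
    using simple_current_rotates[OF rotate_content_funpow_compositions[OF assms]] by simp
  finally show ?case .
qed (simp add: fcong_refl)

definition row_content :: "nat \<Rightarrow> nat \<Rightarrow> nat" where
  "row_content m i = (if i = 0 then k - m else if i = 1 then m else 0)"

lemma row_content_compositions: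
  assumes "m \<le> k"
  shows "row_content m \<in> compositions N k"
proof -
  have "(\<Sum>i<N. row_content m i) = (\<Sum>i\<in>{0, 1}. row_content m i)"
    by (rule sum.mono_neutral_right) (use two_le_N in \<open>auto simp: row_content_def\<close>)
  then show ?thesis using assms two_le_N by (auto simp: compositions_def row_content_def)
qed

text \<open>The fusion Pieri rule applied to the trivial weight, whose content is \<open>k\<close> at \<open>0\<close>.\<close>

lemma schur_content_row:
  assumes "m \<le> k"
  shows "hom_poly N m \<approx> schur_content (row_content m)"
proof -
  define b where "b i = (if i = 0 then k else 0)" for i :: nat
  define d where "d i = (if i = 0 then m else 0)" for i :: nat
  have sum0: "(\<Sum>i<N. if i = 0 then c else 0) = c" for c :: nat using two_le_N by simp
  have b: "b \<in> compositions N k" using two_le_N sum0 by (auto simp: compositions_def b_def)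
  have "sub_contents N b m = {d}"
  proof -
    have "e = d" if e: "e \<in> sub_contents N b m" for e
    proof -
      have z: "e i = 0" if "i \<noteq> 0" for i
        using e that by (cases "i < N") (auto simp: sub_contents_def compositions_def b_def)
      then have "(\<Sum>i<N. e i) = (\<Sum>i<N. if i = 0 then e 0 else 0)" by (intro sum.cong) auto
      then have "e 0 = m" using e sum0 by (simp add: sub_contents_def compositions_def)
      then show ?thesis using z by (auto simp: d_def fun_eq_iff)
    qed
    moreover have "d \<in> sub_contents N b m"
      using assms two_le_N sum0 by (auto simp: sub_contents_def compositions_def d_def b_def)
    ultimately show ?thesis by blast
  qed
  moreover have "move_along N b d = row_content m"
    using two_le_N by (auto simp: fun_eq_iff move_along_def b_def d_def row_content_def)
  moreover have "schur_content b = 1"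
  proof -
    have "schur_content b = jacobi_trudi N (staircase N)"
      unfolding schur_content_def
      by (rule jacobi_trudi_cong) (simp add: exponents_def b_def staircase_def)
    then show ?thesis by (simp add: jacobi_trudi_staircase)
  qed
  ultimately show ?thesis using fusion_pieri[OF b assms] by simp
qed

theorem fusion_product:
  assumes b: "b \<in> compositions N k" and m: "m \<le> k"
  shows "schur_content ((rotate_content N ^^ t) (row_content m)) * schur_content b \<approx>
    (\<Sum>d\<in>sub_contents N b m. schur_content ((rotate_content N ^^ t) (move_along N b d)))"
proof -
  let ?s = "hom_poly N k ^ t"
  have s: "?s \<in> symmetric_polys N" by (intro symmetric_polys_power symmetric_polys_hom_poly)
  have "?s * hom_poly N m \<approx> ?s * schur_content (row_content m)"
    by (rule fcong_mult_left[OF s schur_content_row[OF m]])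
  also have "\<dots> \<approx> schur_content ((rotate_content N ^^ t) (row_content m))"
    by (rule simple_current_power_rotates[OF row_content_compositions[OF m]])
  finally have "schur_content b * schur_content ((rotate_content N ^^ t) (row_content m)) \<approx>
      schur_content b * (?s * hom_poly N m)"
    by (rule fcong_mult_left[OF symmetric_schur_content fcong_sym])
  also have "schur_content b * (?s * hom_poly N m) = ?s * (hom_poly N m * schur_content b)"
    by (simp add: ac_simps)
  also have "\<dots> \<approx> ?s * (\<Sum>d\<in>sub_contents N b m. schur_content (move_along N b d))"
    by (rule fcong_mult_left[OF s fusion_pieri[OF b m]])
  also have "\<dots> = (\<Sum>d\<in>sub_contents N b m. ?s * schur_content (move_along N b d))"
    by (rule sum_distrib_left)
  also have "\<dots> \<approx> (\<Sum>d\<in>sub_contents N b m. schur_content ((rotate_content N ^^ t) (move_along N b d)))"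
    by (intro fcong_sum simple_current_power_rotates move_along_compositions[OF b])
      (simp add: sub_contents_def)
  finally show ?thesis by (simp add: mult.commute)
qed

text \<open>Pairing the alternants with the indicator of the coset of \<open>exponents N b\<close> extracts \<open>c b\<close>, and
  elements of the ideal pair to zero.\<close>

theorem schur_content_independent:
  assumes "(\<Sum>b\<in>compositions N k. const_poly (c b) * schur_content b) \<in> I" "b \<in> compositions N k"
  shows "c b = 0"
proof -
  have N0: "0 < N" using two_le_N by simp
  let ?\<phi> = "alcove_indicator N n (exponents N b)"
  have "annihilated N n (\<Sum>b'\<in>compositions N k. const_poly (c b') * alternant N (exponents N b'))"
    using ideal_annihilated[OF assms(1)]
    by (simp add: sum_distrib_right mult.assoc schur_content_def jacobi_trudi_mult_alternant)
  then have "0 = (\<Sum>b'\<in>compositions N k. c b' * pairing ?\<phi> (alternant N (exponents N b')))"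
    by (simp add: annihilated_def affine_invariant_alcove_indicator pairing_sum const_poly_def
        pairing_single_mult)
  also have "\<dots> = (\<Sum>b'\<in>compositions N k. if b' = b then c b' else 0)"
  proof (intro sum.cong refl)
    fix b' assume b': "b' \<in> compositions N k"
    have "(\<forall>i<N. exponents N b' i = exponents N b i) \<longleftrightarrow> b' = b"
      using exponents_inj[OF N0 b' assms(2)] by auto
    then show "c b' * pairing ?\<phi> (alternant N (exponents N b')) = (if b' = b then c b' else 0)"
      using pairing_alcove_indicator[OF two_le_N alcove_exponents[OF N0 b']
          alcove_exponents[OF N0 assms(2)]] by simp
  qed
  also have "\<dots> = c b" using assms(2) by (simp add: finite_compositions)
  finally show ?thesis by simp
qed

end

section \<open>Orbits and the orbit product\<close>

definition content_class :: "(nat \<Rightarrow> nat) \<Rightarrow> nat list set" where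
  "content_class b = {x. count (mset x) = b}"

lemma perm_orbit_eq_content_class:
  assumes "length x = k"
  shows "perm_orbit k x = content_class (count (mset x))"
proof
  show "perm_orbit k x \<subseteq> content_class (count (mset x))"
    using assms by (auto simp: perm_orbit_def content_class_def)
  show "content_class (count (mset x)) \<subseteq> perm_orbit k x"
  proof
    fix y assume "y \<in> content_class (count (mset x))"
    then have "mset y = mset x" by (simp add: content_class_def multiset_eq_iff fun_eq_iff)
    then obtain s where "s permutes {..<length x}" "permute_list s x = y"
      by (rule mset_eq_permutation)
    then show "y \<in> perm_orbit k x" using assms by (auto simp: perm_orbit_def)
  qed
qed

lemma length_eq_sum_count:
  fixes x :: "nat list"
  assumes "set x \<subseteq> {..<N}"
  shows "length x = (\<Sum>i<N. count (mset x) i)"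
proof -
  have "length x = (\<Sum>i\<in>set x. count (mset x) i)"
    by (metis size_mset size_multiset_overloaded_eq set_mset_mset)
  also have "\<dots> = (\<Sum>i<N. count (mset x) i)"
    using assms by (intro sum.mono_neutral_left) (auto simp: count_eq_zero_iff)
  finally show ?thesis .
qed

lemma count_tuples: "x \<in> tuples N k \<Longrightarrow> count (mset x) \<in> compositions N k"
  using length_eq_sum_count[of x N]
  by (auto simp: tuples_def compositions_def count_eq_zero_iff atLeast0LessThan)

lemma content_class_tuples:
  assumes "b \<in> compositions N k"
  shows "content_class b \<subseteq> tuples N k"
proof
  fix x assume "x \<in> content_class b"
  then have x: "count (mset x) = b" by (simp add: content_class_def)
  have "i < N" if "i \<in> set x" for i
  proof (rule ccontr)
    assume "\<not> i < N"
    then have "count (mset x) i = 0" using assms x by (simp add: compositions_def)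
    then show False using that by (simp add: count_eq_zero_iff)
  qed
  then have "set x \<subseteq> {..<N}" by auto
  then show "x \<in> tuples N k"
    using length_eq_sum_count[of x N] assms x by (auto simp: tuples_def compositions_def)
qed

lemma count_concat_replicate:
  "distinct L \<Longrightarrow> count (mset (concat (map (\<lambda>j. replicate (a j) j) L))) i = (if i \<in> set L then a i else 0)"
  by (induction L) auto

lemma content_class_nonempty:
  assumes "b \<in> compositions N k"
  shows "content_class b \<noteq> {}"
proof -
  have "count (mset (concat (map (\<lambda>j. replicate (b j) j) [0..<N]))) = b"
    using assms by (auto simp: fun_eq_iff count_concat_replicate compositions_def)
  then show ?thesis by (auto simp: content_class_def)
qed

lemma content_class_inj: "content_class b = content_class c \<Longrightarrow> content_class b \<noteq> {} \<Longrightarrow> b = c"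
  by (auto simp: content_class_def)

lemma orbit_set_eq: "orbit_set N k = content_class ` compositions N k"
proof
  show "orbit_set N k \<subseteq> content_class ` compositions N k"
    by (auto simp: orbit_set_def tuples_def perm_orbit_eq_content_class intro!: imageI count_tuples)
  show "content_class ` compositions N k \<subseteq> orbit_set N k"
  proof
    fix C assume "C \<in> content_class ` compositions N k"
    then obtain b where b: "C = content_class b" "b \<in> compositions N k" by blast
    obtain x where x: "x \<in> content_class b" using content_class_nonempty[OF b(2)] by blast
    then have "x \<in> tuples N k" using content_class_tuples[OF b(2)] by blast
    moreover have "perm_orbit k x = C"
      using x b \<open>x \<in> tuples N k\<close>
      by (simp add: perm_orbit_eq_content_class tuples_def content_class_def)
    ultimately show "C \<in> orbit_set N k" by (auto simp: orbit_set_def)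
  qed
qed

lemma finite_orbit_set: "finite (orbit_set N k)"
  by (simp add: orbit_set_eq finite_compositions)

lemma add_tuple_eq_map: "add_tuple N x y = map (\<lambda>(a, v). (a + v) mod N) (zip x y)"
  by (simp add: add_tuple_def)

text \<open>Simultaneous permutations of \<open>x\<close> and \<open>y\<close> are permutations of the list of pairs, and the sum follows
  along.\<close>

lemma triple_orbit_eq:
  assumes "length x = k" "length y = k"
  shows "triple_orbit k (x, y, add_tuple N x y) =
    {(x', y', add_tuple N x' y') | x' y'. length x' = k \<and> length y' = k \<and>
       mset (zip x' y') = mset (zip x y)}" (is "?L = ?R")
proof
  have perm: "permute_list s (add_tuple N x y) = add_tuple N (permute_list s x) (permute_list s y)"
      "permute_list s (zip x y) = zip (permute_list s x) (permute_list s y)"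
    if "s permutes {..<k}" for s
    using that assms unfolding add_tuple_eq_map
    by (simp_all add: permute_list_map permute_list_zip[of s "{..<k}"])
  show "?L \<subseteq> ?R"
    using assms perm mset_permute_list[of _ "zip x y"] unfolding triple_orbit_def by fastforce
  show "?R \<subseteq> ?L"
  proof
    fix T assume "T \<in> ?R"
    then obtain x' y' where T: "T = (x', y', add_tuple N x' y')"
      and l: "length x' = k" "length y' = k" and m: "mset (zip x' y') = mset (zip x y)"
      by blast
    obtain s where s: "s permutes {..<length (zip x y)}" "permute_list s (zip x y) = zip x' y'"
      using mset_eq_permutation[OF m] by blast
    have s': "s permutes {..<k}" using s assms by simp
    have "zip (permute_list s x) (permute_list s y) = zip x' y'" using s(2) perm(2)[OF s'] by simp
    then have "map fst (zip (permute_list s x) (permute_list s y)) = map fst (zip x' y')"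
      "map snd (zip (permute_list s x) (permute_list s y)) = map snd (zip x' y')" by simp_all
    then have "permute_list s x = x'" "permute_list s y = y'"
      using assms l by simp_all
    then show "T \<in> ?L"
      using s' perm(1)[OF s'] unfolding triple_orbit_def T by auto
  qed
qed

lemma card_image_eq:
  assumes "\<And>a b. a \<in> S \<Longrightarrow> b \<in> S \<Longrightarrow> f a = f b \<longleftrightarrow> g a = g b"
  shows "card (f ` S) = card (g ` S)"
proof -
  have "bij_betw (\<lambda>X. g (inv_into S f X)) (f ` S) (g ` S)"
  proof (rule bij_betw_byWitness[where f' = "\<lambda>Y. f (inv_into S g Y)"])
    have f: "inv_into S f (f a) \<in> S \<and> f (inv_into S f (f a)) = f a" if "a \<in> S" for a
      using that by (simp add: inv_into_into f_inv_into_f)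
    have g: "inv_into S g (g a) \<in> S \<and> g (inv_into S g (g a)) = g a" if "a \<in> S" for a
      using that by (simp add: inv_into_into f_inv_into_f)
    show "\<forall>X\<in>f ` S. f (inv_into S g (g (inv_into S f X))) = X"
      using f g assms by (metis (no_types, lifting) imageE)
    show "\<forall>Y\<in>g ` S. g (inv_into S f (f (inv_into S g Y))) = Y"
      using f g assms by (metis (no_types, lifting) imageE)
    show "(\<lambda>X. g (inv_into S f X)) ` f ` S \<subseteq> g ` S" "(\<lambda>Y. f (inv_into S g Y)) ` g ` S \<subseteq> f ` S"
      using f g by auto
  qed
  then show ?thesis by (rule bij_betw_same_card)
qed

lemma sum_triples_cases:
  assumes "T \<in> sum_triples N (content_class a) (content_class b) C"
    "a \<in> compositions N k" "b \<in> compositions N k"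
  obtains x y where "T = (x, y, add_tuple N x y)" "x \<in> content_class a" "y \<in> content_class b"
    "length x = k" "length y = k" "set x \<subseteq> {..<N}" "set y \<subseteq> {..<N}" "add_tuple N x y \<in> C"
proof -
  obtain x y where "T = (x, y, add_tuple N x y)" "x \<in> content_class a" "y \<in> content_class b"
    "add_tuple N x y \<in> C" using assms(1) by (auto simp: sum_triples_def)
  moreover have "x \<in> tuples N k" "y \<in> tuples N k"
    using calculation content_class_tuples assms by blast+
  ultimately show ?thesis using that by (auto simp: tuples_def atLeast0LessThan)
qed

lemma orbit_coeff_eq_card:
  assumes "a \<in> compositions N k" "b \<in> compositions N k"
  shows "orbit_coeff N k (content_class a) (content_class b) C =
    card ((\<lambda>(x, y, z). mset (zip x y)) ` sum_triples N (content_class a) (content_class b) C)"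
  unfolding orbit_coeff_def
proof (rule card_image_eq)
  fix S T
  assume "S \<in> sum_triples N (content_class a) (content_class b) C"
    "T \<in> sum_triples N (content_class a) (content_class b) C"
  then obtain x y x' y' where S: "S = (x, y, add_tuple N x y)" "T = (x', y', add_tuple N x' y')"
    and l: "length x = k" "length y = k" "length x' = k" "length y' = k"
    using assms by (metis sum_triples_cases)
  have "triple_orbit k S = triple_orbit k T \<longleftrightarrow> mset (zip x y) = mset (zip x' y')"
  proof
    assume "triple_orbit k S = triple_orbit k T"
    moreover have "S \<in> triple_orbit k S" unfolding S triple_orbit_eq[OF l(1,2)] using l by auto
    ultimately have "S \<in> triple_orbit k T" by simp
    then show "mset (zip x y) = mset (zip x' y')" unfolding S triple_orbit_eq[OF l(3,4)] by auto
  qed (simp add: S triple_orbit_eq[OF l(1,2)] triple_orbit_eq[OF l(3,4)])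
  then show "triple_orbit k S = triple_orbit k T \<longleftrightarrow>
      (case S of (x, y, z) \<Rightarrow> mset (zip x y)) = (case T of (x, y, z) \<Rightarrow> mset (zip x y))"
    by (simp add: S)
qed

subsection \<open>Contents of sums\<close>

lemma Suc_mod_eq_iff:
  fixes v i N :: nat
  shows "v < N \<Longrightarrow> i < N \<Longrightarrow> (v + 1) mod N = i \<longleftrightarrow> v = (if i = 0 then N - 1 else i - 1)"
  by (cases "v + 1 = N") auto

lemma count_map_Suc_mod:
  assumes "set z \<subseteq> {..<N}"
  shows "count (mset (map (\<lambda>v. (v + 1) mod N) z)) = rotate_content N (count (mset z))"
proof
  fix i
  show "count (mset (map (\<lambda>v. (v + 1) mod N) z)) i = rotate_content N (count (mset z)) i"
  proof (cases "i < N")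
    case True
    show ?thesis using assms
    proof (induction z)
      case (Cons v z)
      then show ?case using Suc_mod_eq_iff[of v N i] True by (simp add: rotate_content_def)
    qed (simp add: rotate_content_def)
  next
    case False
    have "i \<notin> set (map (\<lambda>v. (v + 1) mod N) z)"
    proof
      assume "i \<in> set (map (\<lambda>v. (v + 1) mod N) z)"
      then obtain v where v: "v \<in> set z" "i = (v + 1) mod N" by auto
      then have "0 < N" using assms by auto
      then show False using False v by simp
    qed
    then show ?thesis using False by (simp add: rotate_content_def count_eq_zero_iff)
  qed
qed

lemma count_map_add_mod:
  assumes "set z \<subseteq> {..<N}"
  shows "count (mset (map (\<lambda>v. (v + t) mod N) z)) = (rotate_content N ^^ t) (count (mset z))"
proof (induction t)
  case 0
  have "map (\<lambda>v. (v + 0) mod N) z = z" using assms by (intro map_idI) auto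
  then show ?case by simp
next
  case (Suc t)
  have "map (\<lambda>v. (v + Suc t) mod N) z = map (\<lambda>v. (v + 1) mod N) (map (\<lambda>v. (v + t) mod N) z)"
    by (simp add: mod_Suc_eq)
  moreover have "set (map (\<lambda>v. (v + t) mod N) z) \<subseteq> {..<N}"
    using assms by (cases "N = 0") auto
  ultimately show ?case using count_map_Suc_mod Suc by (metis comp_apply funpow.simps(2))
qed

text \<open>Stated additively, so that no truncated subtraction enters the induction.\<close>

lemma count_map_step:
  fixes w :: "(nat \<times> nat) list"
  assumes "\<forall>(a, v)\<in>set w. v < N" "i < N"
  shows "count (mset (map (\<lambda>(a, v). if a = s then (v + 1) mod N else v) w)) i + count (mset w) (s, i) =
    count (mset (map snd w)) i + count (mset w) (s, if i = 0 then N - 1 else i - 1)"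
  using assms(1)
proof (induction w)
  case (Cons p w)
  obtain a v where "p = (a, v)" by (cases p)
  then show ?case using Cons Suc_mod_eq_iff[of v N i] assms(2) by auto
qed simp

lemma count_pair_le: "count (mset w) (s, v) \<le> count (mset (map snd w)) v"
  by (induction w) auto

lemma count_map_step_eq_move_along:
  fixes w :: "(nat \<times> nat) list"
  assumes "\<forall>(a, v)\<in>set w. v < N"
  shows "count (mset (map (\<lambda>(a, v). if a = s then (v + 1) mod N else v) w)) =
    move_along N (count (mset (map snd w))) (\<lambda>j. count (mset w) (s, j))"
proof
  fix i
  let ?z = "map (\<lambda>(a, v). if a = s then (v + 1) mod N else v) w"
  show "count (mset ?z) i = move_along N (count (mset (map snd w))) (\<lambda>j. count (mset w) (s, j)) i"
  proof (cases "i < N")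
    case True
    then show ?thesis
      using count_map_step[OF assms True, of s] count_pair_le[of w s i] by (simp add: move_along_def)
  next
    case False
    have "i \<notin> set ?z" using assms False by (fastforce split: if_splits)
    then show ?thesis using False by (simp add: move_along_def count_eq_zero_iff)
  qed
qed

lemma count_pairs_two_values:
  assumes "\<forall>(a, v)\<in>set w. a = s \<or> a = u" "s \<noteq> u"
  shows "count (mset w) (u, v) + count (mset w) (s, v) = count (mset (map snd w)) v"
  using assms by (induction w) auto

lemma count_fst_eq_sum:
  fixes w :: "(nat \<times> nat) list"
  assumes "\<forall>(a, v)\<in>set w. v < N"
  shows "(\<Sum>j<N. count (mset w) (s, j)) = count (mset (map fst w)) s"
  using assms
proof (induction w)
  case (Cons p w)
  obtain a v where p: "p = (a, v)" by (cases p)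
  have "(\<Sum>j<N. count (mset (p # w)) (s, j)) =
      (\<Sum>j<N. (if j = v then (if a = s then 1 else 0) else 0) + count (mset w) (s, j))"
    by (intro sum.cong) (auto simp: p)
  then show ?case using Cons by (auto simp: p sum.distrib)
qed simp

lemma length_two_values:
  "set x \<subseteq> {s, u} \<Longrightarrow> s \<noteq> u \<Longrightarrow> length x = count (mset x) s + count (mset x) u"
  by (induction x) auto

definition two_valued :: "nat \<Rightarrow> nat \<Rightarrow> nat \<Rightarrow> nat \<Rightarrow> nat list" where
  "two_valued N k m t = replicate m ((t + 1) mod N) @ replicate (k - m) (t mod N)"

context fusion_level
begin

lemma count_two_valued:
  assumes "m \<le> k"
  shows "count (mset (two_valued N k m t)) = (rotate_content N ^^ t) (row_content m)"
proof -
  let ?z = "replicate m 1 @ replicate (k - m) (0 :: nat)"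
  have "two_valued N k m t = map (\<lambda>v. (v + t) mod N) ?z"
    by (simp add: two_valued_def)
  moreover have "count (mset ?z) = row_content m"
    by (auto simp: row_content_def fun_eq_iff)
  moreover have "set ?z \<subseteq> {..<N}" using two_le_N by auto
  ultimately show ?thesis using count_map_add_mod[of ?z N t] by metis
qed

lemma next_residue_neq: "(t + 1) mod N \<noteq> t mod N"
proof
  assume "(t + 1) mod N = t mod N"
  then have "N dvd 1" by (metis add_diff_cancel_left' le_add1 mod_eq_dvd_iff_nat)
  then show False using two_le_N by simp
qed

text \<open>The orbit of a triple is determined by the numbers \<open>d j\<close> of pairs \<open>(t + 1, j)\<close>: the number of pairs
  \<open>(t, j)\<close> is then \<open>b j - d j\<close>. Every \<open>d\<close> in \<open>sub_contents N b m\<close> arises from a list of pairs written down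
  explicitly.\<close>

theorem orbit_coeff_eq_card_moves:
  assumes m: "m \<le> k" and b: "b \<in> compositions N k"
  shows "orbit_coeff N k (content_class ((rotate_content N ^^ t) (row_content m)))
      (content_class b) (content_class c) =
    card {d \<in> sub_contents N b m. (rotate_content N ^^ t) (move_along N b d) = c}"
proof -
  define a where "a = (rotate_content N ^^ t) (row_content m)"
  define s where "s = (t + 1) mod N"
  define u where "u = t mod N"
  let ?S = "sum_triples N (content_class a) (content_class b) (content_class c)"
  let ?D = "{d \<in> sub_contents N b m. (rotate_content N ^^ t) (move_along N b d) = c}"
  define q where "q = (\<lambda>(x :: nat list, y :: nat list, z :: nat list) j. count (mset (zip x y)) (s, j))"
  have tv: "two_valued N k m t = replicate m s @ replicate (k - m) u"
    by (simp add: two_valued_def s_def u_def)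
  have su: "s \<noteq> u" unfolding s_def u_def by (rule next_residue_neq)
  have a: "a \<in> compositions N k"
    unfolding a_def by (intro rotate_content_funpow_compositions row_content_compositions m)
  have ax: "count (mset x) s = m \<and> set x \<subseteq> {s, u} \<longleftrightarrow> x \<in> content_class a" if "length x = k" for x
  proof -
    have two: "count (mset x) = a \<longleftrightarrow> mset x = mset (two_valued N k m t)"
      unfolding a_def count_two_valued[OF m, symmetric] by (rule count_inject)
    have "count (mset x) s = m \<and> set x \<subseteq> {s, u} \<longleftrightarrow> mset x = mset (two_valued N k m t)"
    proof
      assume x: "count (mset x) s = m \<and> set x \<subseteq> {s, u}"
      have len: "count (mset x) s + count (mset x) u = k"
        using length_two_values[of x s u] x su that by simp
      show "mset x = mset (two_valued N k m t)"
      proof (rule multiset_eqI)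
        fix i
        have "count (mset x) i = 0" if "i \<noteq> s" "i \<noteq> u"
          using x that by (auto simp: count_eq_zero_iff)
        then show "count (mset x) i = count (mset (two_valued N k m t)) i"
          using x su len by (cases "i = s"; cases "i = u") (simp_all add: tv)
      qed
    next
      assume "mset x = mset (two_valued N k m t)"
      moreover from this have "set x = set (two_valued N k m t)" by (rule mset_eq_setD)
      ultimately have "count (mset x) s = m" "set x = set (two_valued N k m t)"
        using su by (simp_all add: tv)
      moreover have "set (two_valued N k m t) \<subseteq> {s, u}" unfolding tv by auto
      ultimately show "count (mset x) s = m \<and> set x \<subseteq> {s, u}" by simp
    qed
    then show ?thesis unfolding content_class_def mem_Collect_eq two .
  qed
  have sum: "add_tuple N x y = map (\<lambda>v. (v + t) mod N)
      (map (\<lambda>(a, v). if a = s then (v + 1) mod N else v) (zip x y))" if "set x \<subseteq> {s, u}" for x y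
    unfolding add_tuple_eq_map map_map
  proof (rule map_cong[OF refl])
    fix p assume p: "p \<in> set (zip x y)"
    obtain a v where av: "p = (a, v)" by (cases p)
    then have "a = s \<or> a = u" using p that by (auto dest: set_zip_leftD)
    moreover have "(s + v) mod N = ((v + 1) mod N + t) mod N" "(u + v) mod N = (v + t) mod N"
      unfolding s_def u_def mod_add_left_eq by (simp_all only: ac_simps)
    ultimately show "(case p of (a, v) \<Rightarrow> (a + v) mod N) = ((\<lambda>v. (v + t) mod N) \<circ>
        (\<lambda>(a, v). if a = s then (v + 1) mod N else v)) p"
      using su by (auto simp: av simp del: mod_add_left_eq)
  qed
  have csum: "count (mset (add_tuple N x y)) =
      (rotate_content N ^^ t) (move_along N b (\<lambda>j. count (mset (zip x y)) (s, j)))"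
    if "set x \<subseteq> {s, u}" "y \<in> content_class b" "length x = k" "length y = k" "set y \<subseteq> {..<N}" for x y
  proof -
    let ?z = "map (\<lambda>(a, v). if a = s then (v + 1) mod N else v) (zip x y)"
    have w: "\<forall>(a, v)\<in>set (zip x y). v < N" using that by (auto dest: set_zip_rightD)
    then have "set ?z \<subseteq> {..<N}" by (auto split: if_splits)
    then have "count (mset (add_tuple N x y)) = (rotate_content N ^^ t) (count (mset ?z))"
      unfolding sum[OF that(1)] by (rule count_map_add_mod)
    also have "count (mset ?z) = move_along N b (\<lambda>j. count (mset (zip x y)) (s, j))"
      using count_map_step_eq_move_along[OF w, of s] that by (simp add: content_class_def)
    finally show ?thesis .
  qed
  have "orbit_coeff N k (content_class a) (content_class b) (content_class c) =
      card ((\<lambda>(x, y, z). mset (zip x y)) ` ?S)"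
    by (rule orbit_coeff_eq_card[OF a b])
  also have "\<dots> = card (q ` ?S)"
  proof (rule card_image_eq)
    fix S T assume ST: "S \<in> ?S" "T \<in> ?S"
    obtain x y where S: "S = (x, y, add_tuple N x y)" "x \<in> content_class a" "y \<in> content_class b"
      "length x = k" "length y = k" using sum_triples_cases[OF ST(1) a b] by metis
    obtain x' y' where T: "T = (x', y', add_tuple N x' y')" "x' \<in> content_class a" "y' \<in> content_class b"
      "length x' = k" "length y' = k" using sum_triples_cases[OF ST(2) a b] by metis
    have "mset (zip x y) = mset (zip x' y')" if "q S = q T"
    proof (rule multiset_eqI)
      fix p :: "nat \<times> nat"
      obtain i v where p: "p = (i, v)" by (cases p)
      have s: "count (mset (zip x y)) (s, v) = count (mset (zip x' y')) (s, v)"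
        using that by (simp add: S T q_def fun_eq_iff)
      have two: "\<forall>(i, v)\<in>set (zip x y). i = s \<or> i = u" "\<forall>(i, v)\<in>set (zip x' y'). i = s \<or> i = u"
        using S T ax[of x] ax[of x'] by (auto dest: set_zip_leftD)
      consider "i = s" | "i = u" | "i \<noteq> s" "i \<noteq> u" by blast
      then show "count (mset (zip x y)) p = count (mset (zip x' y')) p"
      proof cases
        case 2
        have "count (mset y) v = count (mset y') v" using S T by (simp add: content_class_def)
        then show ?thesis
          using count_pairs_two_values[OF two(1) su, of v] count_pairs_two_values[OF two(2) su, of v]
            s S T 2 p by simp
      next
        case 3
        then have "p \<notin> set (zip x y)" "p \<notin> set (zip x' y')" using two p by auto
        then show ?thesis by (metis count_eq_zero_iff set_mset_mset)
      qed (use s p in simp)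
    qed
    moreover have "q S = q T" if "mset (zip x y) = mset (zip x' y')"
      using that by (simp add: S T q_def)
    ultimately show "(case S of (x, y, z) \<Rightarrow> mset (zip x y)) = (case T of (x, y, z) \<Rightarrow> mset (zip x y))
        \<longleftrightarrow> q S = q T"
      by (auto simp: S T)
  qed
  also have "q ` ?S = ?D"
  proof
    show "q ` ?S \<subseteq> ?D"
    proof
      fix d assume "d \<in> q ` ?S"
      then obtain T where "T \<in> ?S" "d = q T" by blast
      then obtain x y where T: "T = (x, y, add_tuple N x y)" "x \<in> content_class a" "y \<in> content_class b"
        "length x = k" "length y = k" "set y \<subseteq> {..<N}" "add_tuple N x y \<in> content_class c"
        using sum_triples_cases[OF _ a b] by metis
      have d: "d = (\<lambda>j. count (mset (zip x y)) (s, j))" using T \<open>d = q T\<close> by (simp add: q_def)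
      have w: "\<forall>(a, v)\<in>set (zip x y). v < N" using T by (auto dest: set_zip_rightD)
      have x: "count (mset x) s = m" "set x \<subseteq> {s, u}" using ax[OF T(4)] T(2) by auto
      have "(\<Sum>j<N. d j) = m" using count_fst_eq_sum[OF w, of s] x T by (simp add: d)
      moreover have "d j = 0" if "j \<ge> N" for j
      proof -
        have "(s, j) \<notin> set (zip x y)" using w that by auto
        then show ?thesis by (simp add: d count_eq_zero_iff)
      qed
      moreover have "d j \<le> b j" for j
        using count_pair_le[of "zip x y" s j] T by (simp add: d content_class_def)
      moreover have "(rotate_content N ^^ t) (move_along N b d) = c"
        using csum[OF x(2) T(3-6)] T(7) by (simp add: d content_class_def)
      ultimately show "d \<in> ?D" by (auto simp: sub_contents_def compositions_def)
    qed
    show "?D \<subseteq> q ` ?S"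
    proof
      fix d assume d: "d \<in> ?D"
      define w where "w = concat (map (\<lambda>j. replicate (d j) (s, j) @ replicate (b j - d j) (u, j)) [0..<N])"
      define x where "x = map fst w"
      define y where "y = map snd w"
      have cw: "count (mset (concat (map (\<lambda>j. replicate (d j) (s, j) @ replicate (b j - d j) (u, j)) L))) (s, j)
          = (if j \<in> set L then d j else 0)" if "distinct L" for L j
        using that su by (induction L) auto
      have cy: "count (mset (map snd (concat (map (\<lambda>j. replicate (d j) (s, j) @ replicate (b j - d j) (u, j)) L)))) j
          = (if j \<in> set L then b j else 0)" if "distinct L" "\<forall>j\<in>set L. d j \<le> b j" for L j
        using that by (induction L) auto
      have dj: "d j \<le> b j" if "j < N" for j using d that by (simp add: sub_contents_def)
      have zip: "zip x y = w" by (simp add: x_def y_def zip_map_fst_snd)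
      have dw: "d = (\<lambda>j. count (mset w) (s, j))"
        using d cw[of "[0..<N]"] by (auto simp: w_def fun_eq_iff sub_contents_def compositions_def)
      have "count (mset y) = b"
        using b cy[of "[0..<N]"] dj by (auto simp: y_def w_def fun_eq_iff compositions_def)
      then have y: "y \<in> content_class b" by (simp add: content_class_def)
      then have yt: "length y = k" "set y \<subseteq> {..<N}"
        using content_class_tuples[OF b] by (auto simp: tuples_def atLeast0LessThan)
      then have lx: "length x = k" by (simp add: x_def y_def)
      have wv: "\<forall>(a, v)\<in>set w. v < N" by (auto simp: w_def)
      have "count (mset x) s = m"
        using count_fst_eq_sum[OF wv, of s] d unfolding x_def dw[symmetric]
        by (simp add: sub_contents_def compositions_def fun_cong[OF dw, symmetric])
      moreover have sx: "set x \<subseteq> {s, u}" by (auto simp: x_def w_def)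
      ultimately have "x \<in> content_class a" using ax[OF lx] by blast
      moreover have "add_tuple N x y \<in> content_class c"
        using csum[OF sx y lx yt] d dw by (simp add: zip content_class_def)
      ultimately have "(x, y, add_tuple N x y) \<in> ?S" using y by (simp add: sum_triples_def)
      moreover have "q (x, y, add_tuple N x y) = d" using dw by (simp add: q_def zip)
      ultimately show "d \<in> q ` ?S" by (metis imageI)
    qed
  qed
  finally show ?thesis by (simp add: a_def)
qed

lemma content_class_constant:
  assumes "s < N"
  shows "content_class (count (mset (replicate k s))) = {replicate k s}"
    and "count (mset (replicate k s)) \<in> compositions N k"
proof -
  show "count (mset (replicate k s)) \<in> compositions N k"
    using assms by (intro count_tuples) (auto simp: tuples_def)
  have "x = replicate k s" if "mset x = mset (replicate k s)" for x
    using mset_eq_length[OF that] mset_eq_setD[OF that] by (intro replicate_eqI) auto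
  then show "content_class (count (mset (replicate k s))) = {replicate k s}"
    by (auto simp: content_class_def multiset_eq_iff fun_eq_iff simp del: mset_replicate)
qed

text \<open>All triples \<open>(x, y, x + y)\<close> with constant \<open>y\<close> are permutations of each other, so the product is a single
  orbit with coefficient one.\<close>

lemma orbit_prod_constant:
  assumes a: "a \<in> compositions N k" and s: "s < N"
  shows "orbit_prod N k (Poly_Mapping.single (content_class a) 1) (Poly_Mapping.single {replicate k s} 1) =
    Poly_Mapping.single (content_class ((rotate_content N ^^ s) a)) 1"
proof -
  define a' where "a' = (rotate_content N ^^ s) a"
  have a': "a' \<in> compositions N k" unfolding a'_def by (rule rotate_content_funpow_compositions[OF a])
  note const = content_class_constant[OF s]
  have add: "add_tuple N x (replicate k s) \<in> content_class a'" if "x \<in> content_class a" for x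
  proof -
    have x: "length x = k" "set x \<subseteq> {..<N}"
      using content_class_tuples[OF a] that by (auto simp: tuples_def atLeast0LessThan)
    have "add_tuple N x (replicate k s) = map (\<lambda>v. (v + s) mod N) x"
      using x by (auto simp: add_tuple_def intro!: nth_equalityI)
    then show ?thesis
      using count_map_add_mod[OF x(2), of s] that by (simp add: content_class_def a'_def)
  qed
  have coeff: "orbit_coeff N k (content_class a) {replicate k s} (content_class c) = (if c = a' then 1 else 0)" for c
  proof -
    let ?S = "sum_triples N (content_class a) {replicate k s} (content_class c)"
    have "orbit_coeff N k (content_class a) {replicate k s} (content_class c) =
        card ((\<lambda>(x, y, z). mset (zip x y)) ` ?S)"
      using orbit_coeff_eq_card[OF a const(2)] by (simp only: const(1))
    also have "\<dots> = (if c = a' then 1 else 0)"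
    proof (cases "c = a'")
      case True
      obtain x0 where x0: "x0 \<in> content_class a" using content_class_nonempty[OF a] by blast
      have z: "mset (zip x (replicate k s)) = image_mset (\<lambda>v. (v, s)) (mset x0)" if "x \<in> content_class a" for x
      proof -
        have "length x = k" using content_class_tuples[OF a] that by (auto simp: tuples_def)
        then have "zip x (replicate k s) = map (\<lambda>v. (v, s)) x" by (auto intro!: nth_equalityI)
        moreover have "mset x = mset x0"
          using that x0 by (simp add: content_class_def multiset_eq_iff)
        ultimately show ?thesis by (metis mset_map)
      qed
      have "(\<lambda>(x, y, z). mset (zip x y)) ` ?S = {image_mset (\<lambda>v. (v, s)) (mset x0)}"
      proof
        show "(\<lambda>(x, y, z). mset (zip x y)) ` ?S \<subseteq> {image_mset (\<lambda>v. (v, s)) (mset x0)}"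
          using z by (auto simp: sum_triples_def)
        have "(x0, replicate k s, add_tuple N x0 (replicate k s)) \<in> ?S"
          using x0 add True by (simp add: sum_triples_def)
        then show "{image_mset (\<lambda>v. (v, s)) (mset x0)} \<subseteq> (\<lambda>(x, y, z). mset (zip x y)) ` ?S"
          using z[OF x0] by force
      qed
      then show ?thesis using True by simp
    next
      case False
      then have "?S = {}" using add by (auto simp: sum_triples_def content_class_def)
      then show ?thesis using False by simp
    qed
    finally show ?thesis .
  qed
  have "orbit_prod N k (Poly_Mapping.single (content_class a) 1) (Poly_Mapping.single {replicate k s} 1) =
      (\<Sum>C\<in>orbit_set N k. Poly_Mapping.single C
        (of_nat (orbit_coeff N k (content_class a) {replicate k s} C)))"
    by (simp add: orbit_prod_def)
  also have "\<dots> = (\<Sum>C\<in>orbit_set N k. if C = content_class a' then Poly_Mapping.single C 1 else 0)"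
  proof (intro sum.cong refl)
    fix C assume "C \<in> orbit_set N k"
    then obtain c where c: "C = content_class c" "c \<in> compositions N k" by (auto simp: orbit_set_eq)
    have "c = a' \<longleftrightarrow> C = content_class a'"
      using content_class_inj[of c a'] content_class_nonempty[OF c(2)] c by auto
    then show "Poly_Mapping.single C (of_nat (orbit_coeff N k (content_class a) {replicate k s} C)) =
        (if C = content_class a' then Poly_Mapping.single C 1 else (0 :: orbit_comb))"
      using coeff[of c] c(1) by auto
  qed
  also have "\<dots> = Poly_Mapping.single (content_class a') 1"
    using a' by (simp add: finite_orbit_set) (simp add: orbit_set_eq)
  finally show ?thesis by (simp add: a'_def)
qed

lemma rotate_constant:
  assumes "s < N"
  shows "(rotate_content N ^^ t) (count (mset (replicate k s))) = count (mset (replicate k ((s + t) mod N)))"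
  using count_map_add_mod[of "replicate k s" N t] assms by (simp add: subset_iff)

lemma orbit_power_constant:
  assumes "t < N"
  shows "orbit_power N k (Poly_Mapping.single {replicate k 1} 1) t = Poly_Mapping.single {replicate k t} 1"
  using assms
proof (induction t)
  case 0
  have "perm_orbit k (replicate k 0) = {replicate k 0}"
    using perm_orbit_eq_content_class[of "replicate k 0" k] content_class_constant(1)[of 0] two_le_N by simp
  then show ?case by simp
next
  case (Suc t)
  have "1 < N" using two_le_N by simp
  have t: "t < N" using Suc by simp
  have "orbit_power N k (Poly_Mapping.single {replicate k 1} 1) (Suc t) =
      orbit_prod N k (Poly_Mapping.single (content_class (count (mset (replicate k t)))) 1)
        (Poly_Mapping.single {replicate k 1} 1)"
    using Suc t content_class_constant(1)[OF t] by simp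
  also have "\<dots> = Poly_Mapping.single (content_class ((rotate_content N ^^ 1) (count (mset (replicate k t))))) 1"
    by (rule orbit_prod_constant[OF content_class_constant(2)[OF t] \<open>1 < N\<close>])
  also have "(rotate_content N ^^ 1) (count (mset (replicate k t))) = count (mset (replicate k (Suc t)))"
    using rotate_constant[OF t, of 1] Suc by simp
  also have "content_class (count (mset (replicate k (Suc t)))) = {replicate k (Suc t)}"
    by (rule content_class_constant(1)[OF Suc.prems])
  finally show ?case .
qed

section \<open>Weights and the fusion algebra\<close>

text \<open>The multiplicities of the residues in the tuples that correspond to the weight, including \<open>a\<^sub>0\<close>.\<close>

definition weight_content :: "weight \<Rightarrow> nat \<Rightarrow> nat" where
  "weight_content a i = (if i = 0 then k - (\<Sum>j = 1..<N. a j) else a i)"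

lemma sum_lessThan_split: "(\<Sum>i<N. f i) = f 0 + (\<Sum>j = 1..<N. f j :: nat)"
  using two_le_N by (simp add: sum.atLeast_Suc_lessThan flip: atLeast0LessThan)

lemma bij_betw_weight_content: "bij_betw weight_content (weights N k) (compositions N k)"
proof (rule bij_betwI[where g = "\<lambda>b. b(0 := 0)"])
  show "weight_content \<in> weights N k \<rightarrow> compositions N k"
    using two_le_N by (auto simp: weights_def compositions_def weight_content_def sum_lessThan_split)
  show "(\<lambda>b. b(0 := 0)) \<in> compositions N k \<rightarrow> weights N k"
    by (auto simp: weights_def compositions_def sum_lessThan_split Suc_le_eq not_less)
  show "(weight_content a)(0 := 0) = a" if "a \<in> weights N k" for a
    using that by (auto simp: weight_content_def weights_def fun_eq_iff)
  show "weight_content (b(0 := 0)) = b" if "b \<in> compositions N k" for b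
  proof -
    have "(\<Sum>j = 1..<N. (b(0 := 0)) j) = (\<Sum>j = 1..<N. b j)" by (intro sum.cong) auto
    then show ?thesis using that
      by (auto simp: weight_content_def compositions_def sum_lessThan_split fun_eq_iff)
  qed
qed

lemma weight_content_compositions: "a \<in> weights N k \<Longrightarrow> weight_content a \<in> compositions N k"
  using bij_betw_weight_content by (auto simp: bij_betw_def)

lemma weight_orbit_eq:
  assumes "a \<in> weights N k"
  shows "weight_orbit N k a = content_class (weight_content a)"
proof -
  let ?x = "concat (map (\<lambda>j. replicate (a j) j) (rev [1..<N])) @ replicate (k - (\<Sum>j = 1..<N. a j)) 0"
  have c: "count (mset ?x) = weight_content a"
  proof
    fix i
    have "count (mset (concat (map (\<lambda>j. replicate (a j) j) (rev [1..<N])))) i = (if i \<in> {1..<N} then a i else 0)"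
      by (subst count_concat_replicate) auto
    then show "count (mset ?x) i = weight_content a i"
      using assms by (auto simp: weight_content_def weights_def)
  qed
  then have "?x \<in> content_class (weight_content a)" by (simp add: content_class_def)
  then have "length ?x = k"
    using content_class_tuples[OF weight_content_compositions[OF assms]] by (auto simp: tuples_def)
  then show ?thesis
    unfolding weight_orbit_def by (subst perm_orbit_eq_content_class) (simp_all only: c)
qed

lemma schur_weight_partition:
  assumes "a \<in> weights N k"
  shows "schur N (weight_partition N a) = schur_content (weight_content a)"
  unfolding schur_eq_jacobi_trudi schur_content_def
proof (rule jacobi_trudi_cong)
  fix i assume i: "i < N"
  have "weight_partition N a ! i = (\<Sum>j = Suc i..<N. a j)"
    using i by (simp add: weight_partition_def nth_map_upt del: upt_Suc)
  moreover have "exponents N (weight_content a) i = (\<Sum>j = Suc i..<N. a j + 1)"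
    unfolding exponents_def by (intro sum.cong) (auto simp: weight_content_def)
  moreover have "(\<Sum>j = Suc i..<N. a j + 1) = (\<Sum>j = Suc i..<N. a j) + (N - Suc i)"
    by (simp only: sum.distrib) simp
  ultimately show "weight_partition N a ! i + staircase N i = exponents N (weight_content a) i"
    by (simp add: staircase_def)
qed

lemma weight_orbit_eq_iff:
  assumes "a \<in> weights N k" "b \<in> compositions N k"
  shows "weight_orbit N k a = content_class b \<longleftrightarrow> weight_content a = b"
  using content_class_inj[of "weight_content a" b]
    content_class_nonempty[OF weight_content_compositions[OF assms(1)]]
  by (auto simp: weight_orbit_eq[OF assms(1)])

lemma row_weight_orbit:
  assumes "m \<le> k"
  shows "weight_orbit N k (scale_weight m (fundamental_weight 1)) = content_class (row_content m)"
proof -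
  let ?a = "scale_weight m (fundamental_weight 1)"
  have "(\<Sum>j = 1..<N. ?a j) = (\<Sum>j = 1..<N. if j = 1 then m else 0)"
    by (intro sum.cong) (auto simp: scale_weight_def fundamental_weight_def)
  then have s: "(\<Sum>j = 1..<N. ?a j) = m" using two_le_N by simp
  have "?a \<in> weights N k"
    using s assms two_le_N by (auto simp: weights_def scale_weight_def fundamental_weight_def)
  moreover have "weight_content ?a = row_content m"
    using s by (auto simp: fun_eq_iff weight_content_def row_content_def scale_weight_def
        fundamental_weight_def)
  ultimately show ?thesis by (simp add: weight_orbit_eq)
qed

theorem row_orbit_times_current_power:
  assumes "m \<le> k" "t < N"
  shows "orbit_prod N k (Poly_Mapping.single (weight_orbit N k (scale_weight m (fundamental_weight 1))) 1)
      (orbit_power N k (Poly_Mapping.single (weight_orbit N k (scale_weight k (fundamental_weight 1))) 1) t) =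
    Poly_Mapping.single (content_class ((rotate_content N ^^ t) (row_content m))) 1"
proof -
  have "row_content k = count (mset (replicate k 1))"
    by (auto simp: row_content_def fun_eq_iff)
  then have current: "weight_orbit N k (scale_weight k (fundamental_weight 1)) = {replicate k 1}"
    using row_weight_orbit[of k] content_class_constant(1)[of 1] two_le_N by simp
  show ?thesis
    unfolding current row_weight_orbit[OF assms(1)] orbit_power_constant[OF assms(2)]
    by (rule orbit_prod_constant[OF row_content_compositions[OF assms(1)] assms(2)])
qed

sublocale quotient: ring_hom_cring R "fusion_algebra N k" "fusion_class N k"
  using I.rcos_ring_hom_cring[OF R.is_cring]
  unfolding fusion_algebra_def fusion_class_def[abs_def] .

lemma fusion_class_eq_iff:
  assumes "p \<in> symmetric_polys N" "q \<in> symmetric_polys N"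
  shows "fusion_class N k p = fusion_class N k q \<longleftrightarrow> p \<approx> q"
proof -
  have "p \<approx> q \<longleftrightarrow> p \<oplus>\<^bsub>R\<^esub> \<ominus>\<^bsub>R\<^esub> q \<in> I"
    using assms by (simp add: fcong_def symmetric_ring_minus)
  also have "\<dots> \<longleftrightarrow> p \<in> I +>\<^bsub>R\<^esub> q"
    using I.a_rcos_module[of q p] assms by simp
  also have "\<dots> \<longleftrightarrow> I +>\<^bsub>R\<^esub> p = I +>\<^bsub>R\<^esub> q"
    using I.a_repr_independence' I.a_rcos_self assms by auto
  finally show ?thesis by (simp add: fusion_class_def)
qed

lemma finsum_symmetric_ring:
  assumes "\<And>i. i \<in> A \<Longrightarrow> f i \<in> symmetric_polys N"
  shows "finsum R f A = sum f A"
  using assms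
  by (induction A rule: infinite_finite_induct)
    (auto simp: R.finsum_infinite R.finsum_insert Pi_def)

text \<open>Transfers the expansion from the quotient ring to a congruence of polynomials.\<close>

lemma is_fusion_expansion_iff:
  assumes "\<kappa> \<in> weights N k" "\<mu> \<in> weights N k"
  shows "is_fusion_expansion N k \<kappa> \<mu> c \<longleftrightarrow>
    (\<forall>\<nu>. \<nu> \<notin> weights N k \<longrightarrow> c \<nu> = 0) \<and>
    schur_content (weight_content \<kappa>) * schur_content (weight_content \<mu>) \<approx>
      (\<Sum>\<nu>\<in>weights N k. const_poly (c \<nu>) * schur_content (weight_content \<nu>))"
proof -
  let ?S = "\<lambda>\<nu>. schur_content (weight_content \<nu>)"
  have cls: "schur_class N k \<nu> = fusion_class N k (?S \<nu>)" if "\<nu> \<in> weights N k" for \<nu>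
    by (simp add: schur_class_def schur_weight_partition that)
  have "schur_class N k \<kappa> \<otimes>\<^bsub>fusion_algebra N k\<^esub> schur_class N k \<mu> = fusion_class N k (?S \<kappa> * ?S \<mu>)"
    using quotient.hom_mult[of "?S \<kappa>" "?S \<mu>"] assms by (simp add: cls symmetric_schur_content)
  moreover have "(\<Oplus>\<^bsub>fusion_algebra N k\<^esub> \<nu> \<in> weights N k.
      fusion_class N k (const_poly (c \<nu>)) \<otimes>\<^bsub>fusion_algebra N k\<^esub> schur_class N k \<nu>) =
    fusion_class N k (\<Sum>\<nu>\<in>weights N k. const_poly (c \<nu>) * ?S \<nu>)"
  proof -
    have sym: "const_poly (c \<nu>) * ?S \<nu> \<in> symmetric_polys N" for \<nu>
      by (intro symmetric_polys_mult symmetric_polys_const symmetric_schur_content)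
    have "(\<Oplus>\<^bsub>fusion_algebra N k\<^esub> \<nu> \<in> weights N k.
        fusion_class N k (const_poly (c \<nu>)) \<otimes>\<^bsub>fusion_algebra N k\<^esub> schur_class N k \<nu>) =
      (\<Oplus>\<^bsub>fusion_algebra N k\<^esub> \<nu> \<in> weights N k. fusion_class N k (const_poly (c \<nu>) * ?S \<nu>))"
    proof (rule quotient.S.finsum_cong')
      fix \<nu> assume "\<nu> \<in> weights N k"
      then show "fusion_class N k (const_poly (c \<nu>)) \<otimes>\<^bsub>fusion_algebra N k\<^esub> schur_class N k \<nu> =
          fusion_class N k (const_poly (c \<nu>) * ?S \<nu>)"
        using quotient.hom_mult[of "const_poly (c \<nu>)" "?S \<nu>"]
        by (simp add: cls symmetric_schur_content symmetric_polys_const)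
    qed (use sym quotient.hom_closed in auto)
    also have "\<dots> = fusion_class N k (finsum R (\<lambda>\<nu>. const_poly (c \<nu>) * ?S \<nu>) (weights N k))"
      using quotient.hom_finsum[of "\<lambda>\<nu>. const_poly (c \<nu>) * ?S \<nu>" "weights N k"] sym
      by (simp add: comp_def Pi_def)
    finally show ?thesis using sym by (simp add: finsum_symmetric_ring)
  qed
  moreover have "?S \<kappa> * ?S \<mu> \<in> symmetric_polys N"
    "(\<Sum>\<nu>\<in>weights N k. const_poly (c \<nu>) * ?S \<nu>) \<in> symmetric_polys N"
    by (intro symmetric_polys_sum symmetric_polys_mult symmetric_polys_const symmetric_schur_content)+
  ultimately show ?thesis
    unfolding is_fusion_expansion_def by (simp add: fusion_class_eq_iff)
qed

lemma sum_weights_eq: "(\<Sum>\<nu>\<in>weights N k. f (weight_content \<nu>)) = sum f (compositions N k)"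
  by (rule sum.reindex_bij_betw[OF bij_betw_weight_content])

lemma const_poly_diff: "const_poly (a - b) = const_poly a - const_poly b"
  by (simp add: const_poly_def single_diff)

lemma is_fusion_expansion_unique:
  assumes "\<kappa> \<in> weights N k" "\<mu> \<in> weights N k"
    and "is_fusion_expansion N k \<kappa> \<mu> c" "is_fusion_expansion N k \<kappa> \<mu> c'"
  shows "c = c'"
proof
  fix \<nu>
  show "c \<nu> = c' \<nu>"
  proof (cases "\<nu> \<in> weights N k")
    case False
    then show ?thesis using assms(3,4) by (simp add: is_fusion_expansion_def)
  next
    case True
    define g where "g = inv_into (weights N k) weight_content"
    have g: "g (weight_content \<nu>) = \<nu>" if "\<nu> \<in> weights N k" for \<nu>
      unfolding g_def using bij_betw_weight_content that by (simp add: bij_betw_def)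
    let ?T = "\<lambda>c. \<Sum>\<nu>\<in>weights N k. const_poly (c \<nu>) * schur_content (weight_content \<nu>)"
    note e = assms(3,4)[unfolded is_fusion_expansion_iff[OF assms(1,2)]]
    have "?T c \<approx> ?T c'"
      by (rule fcong_trans[OF fcong_sym[OF conjunct2[OF e(1)]] conjunct2[OF e(2)]])
    then have "(\<Sum>\<nu>\<in>weights N k. const_poly (c \<nu> - c' \<nu>) * schur_content (weight_content \<nu>)) \<in> I"
      by (simp add: fcong_def const_poly_diff left_diff_distrib sum_subtractf)
    also have "(\<Sum>\<nu>\<in>weights N k. const_poly (c \<nu> - c' \<nu>) * schur_content (weight_content \<nu>)) =
        (\<Sum>\<nu>\<in>weights N k. (\<lambda>b. const_poly (c (g b) - c' (g b)) * schur_content b) (weight_content \<nu>))"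
      by (intro sum.cong) (auto simp: g)
    also have "\<dots> = (\<Sum>b\<in>compositions N k. const_poly (c (g b) - c' (g b)) * schur_content b)"
      by (rule sum_weights_eq)
    finally have "c (g (weight_content \<nu>)) - c' (g (weight_content \<nu>)) = 0"
      by (rule schur_content_independent) (rule weight_content_compositions[OF True])
    then show ?thesis using g[OF True] by simp
  qed
qed

lemma const_poly_of_nat: "const_poly (of_nat j) = of_nat j"
  by (simp add: const_poly_def)

text \<open>Collecting equal terms in \<open>fusion_product\<close> yields an expansion, and independence makes it the only one.\<close>

theorem fusion_coeff_eq_card_moves:
  assumes m: "m \<le> k" and w: "\<kappa> \<in> weights N k" "\<mu> \<in> weights N k" "\<nu> \<in> weights N k"
    and \<kappa>: "weight_content \<kappa> = (rotate_content N ^^ t) (row_content m)"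
  shows "fusion_coeff N k \<kappa> \<mu> \<nu> =
    of_nat (card {d \<in> sub_contents N (weight_content \<mu>) m.
      (rotate_content N ^^ t) (move_along N (weight_content \<mu>) d) = weight_content \<nu>})"
proof -
  let ?b = "weight_content \<mu>"
  let ?g = "\<lambda>d. (rotate_content N ^^ t) (move_along N ?b d)"
  define M where "M c = card {d \<in> sub_contents N ?b m. ?g d = c}" for c
  define C where "C \<nu> = (if \<nu> \<in> weights N k then of_nat (M (weight_content \<nu>)) else 0 :: rat)" for \<nu>
  have b: "?b \<in> compositions N k" by (rule weight_content_compositions[OF w(2)])
  have "schur_content (weight_content \<kappa>) * schur_content ?b \<approx>
      (\<Sum>d\<in>sub_contents N ?b m. schur_content (?g d))"
    unfolding \<kappa> by (rule fusion_product[OF b m])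
  also have "\<dots> = (\<Sum>c\<in>compositions N k. \<Sum>d | d \<in> sub_contents N ?b m \<and> ?g d = c. schur_content (?g d))"
  proof (rule sum.group[symmetric])
    show "?g ` sub_contents N ?b m \<subseteq> compositions N k"
      using b by (auto simp: sub_contents_def
          intro!: rotate_content_funpow_compositions move_along_compositions)
  qed (simp_all add: finite_sub_contents finite_compositions)
  also have "\<dots> = (\<Sum>c\<in>compositions N k. const_poly (of_nat (M c)) * schur_content c)"
    by (intro sum.cong refl) (simp add: M_def const_poly_of_nat)
  also have "\<dots> = (\<Sum>\<nu>\<in>weights N k. const_poly (C \<nu>) * schur_content (weight_content \<nu>))"
    using sum_weights_eq[of "\<lambda>c. const_poly (of_nat (M c)) * schur_content c"] by (simp add: C_def)
  finally have "is_fusion_expansion N k \<kappa> \<mu> C"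
    unfolding is_fusion_expansion_iff[OF w(1,2)] by (simp add: C_def)
  then have "(THE c. is_fusion_expansion N k \<kappa> \<mu> c) = C"
    using is_fusion_expansion_unique[OF w(1,2)] by (intro the_equality)
  then show ?thesis using w(3) by (simp add: fusion_coeff_def C_def M_def)
qed

end

theorem theorem5p1p7:
  fixes N k m t :: nat and p :: orbit_comb
  assumes "N \<ge> 2" and "k \<ge> 1" and "m \<le> k" and "t \<le> N - 1"
  assumes "p = orbit_prod N k
      (Poly_Mapping.single (weight_orbit N k (scale_weight m (fundamental_weight 1))) 1)
      (orbit_power N k
        (Poly_Mapping.single (weight_orbit N k (scale_weight k (fundamental_weight 1))) 1) t)"
  shows "(\<exists>!\<kappa>. \<kappa> \<in> weights N k \<and> Poly_Mapping.single (weight_orbit N k \<kappa>) 1 = p) \<and>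
    (\<forall>\<kappa> \<in> weights N k. Poly_Mapping.single (weight_orbit N k \<kappa>) 1 = p \<longrightarrow>
      (\<forall>\<mu> \<in> weights N k. \<forall>\<nu> \<in> weights N k.
        fusion_coeff N k \<kappa> \<mu> \<nu> =
          of_nat (orbit_coeff N k (weight_orbit N k \<kappa>) (weight_orbit N k \<mu>) (weight_orbit N k \<nu>))))"
proof -
  interpret fusion_level N k by unfold_locales (rule assms(1))
  define a where "a = (rotate_content N ^^ t) (row_content m)"
  have a: "a \<in> compositions N k"
    unfolding a_def by (intro rotate_content_funpow_compositions row_content_compositions assms)
  have "t < N" using assms by simp
  then have p: "p = Poly_Mapping.single (content_class a) 1"
    using row_orbit_times_current_power[OF assms(3)] assms(5) by (simp add: a_def)
  have iff: "Poly_Mapping.single (weight_orbit N k \<kappa>) 1 = p \<longleftrightarrow> weight_content \<kappa> = a"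
    if "\<kappa> \<in> weights N k" for \<kappa>
  proof -
    have "Poly_Mapping.single (weight_orbit N k \<kappa>) 1 = p \<longleftrightarrow> weight_orbit N k \<kappa> = content_class a"
    proof
      assume "Poly_Mapping.single (weight_orbit N k \<kappa>) 1 = p"
      then have "Poly_Mapping.keys (Poly_Mapping.single (weight_orbit N k \<kappa>) (1::rat)) =
          Poly_Mapping.keys (Poly_Mapping.single (content_class a) (1::rat))" by (simp only: p)
      then show "weight_orbit N k \<kappa> = content_class a" by simp
    qed (simp add: p)
    then show ?thesis using weight_orbit_eq_iff[OF that a] by simp
  qed
  obtain \<kappa>0 where \<kappa>0: "\<kappa>0 \<in> weights N k" "weight_content \<kappa>0 = a"
    using bij_betw_weight_content a unfolding bij_betw_def by (metis imageE)
  have "\<exists>!\<kappa>. \<kappa> \<in> weights N k \<and> Poly_Mapping.single (weight_orbit N k \<kappa>) 1 = p"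
  proof (rule ex1I[of _ \<kappa>0])
    show "\<kappa>0 \<in> weights N k \<and> Poly_Mapping.single (weight_orbit N k \<kappa>0) 1 = p"
      using \<kappa>0 iff by simp
    fix \<kappa> assume "\<kappa> \<in> weights N k \<and> Poly_Mapping.single (weight_orbit N k \<kappa>) 1 = p"
    then have "\<kappa> \<in> weights N k" "weight_content \<kappa> = weight_content \<kappa>0" using iff \<kappa>0 by auto
    then show "\<kappa> = \<kappa>0"
      using bij_betw_weight_content \<kappa>0 by (auto simp: bij_betw_def dest: inj_onD)
  qed
  moreover have "fusion_coeff N k \<kappa> \<mu> \<nu> =
      of_nat (orbit_coeff N k (weight_orbit N k \<kappa>) (weight_orbit N k \<mu>) (weight_orbit N k \<nu>))"
    if "\<kappa> \<in> weights N k" "Poly_Mapping.single (weight_orbit N k \<kappa>) 1 = p"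
      "\<mu> \<in> weights N k" "\<nu> \<in> weights N k" for \<kappa> \<mu> \<nu>
  proof -
    have "weight_content \<kappa> = a" using iff that by simp
    then show ?thesis
      using fusion_coeff_eq_card_moves[OF assms(3) that(1,3,4), of t]
        orbit_coeff_eq_card_moves[OF assms(3) weight_content_compositions[OF that(3)], of t]
      by (simp add: weight_orbit_eq that a_def)
  qed
  ultimately show ?thesis by blast
qed

end
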